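(* Let $p_1$ be a prime with $p_1\equiv 7 \pmod 8$, let $m$ be a positive integer, and let $N=2p_1^m$. Let $p$ be a prime with $\gcd(p,N)=1$ such that $-1\notin\langle p\rangle$ and $\langle p\rangle$ has index $2$ in $(\mathbb{Z}/N\mathbb{Z})^*$, where $\langle p\rangle$ denotes the cyclic subgroup of $(\mathbb{Z}/N\mathbb{Z})^*$ generated by $p \bmod N$. Put $f=\mathrm{ord}_N(p)=\phi(N)/2$ and $q=p^f$. Let $s$ be an odd positive integer, let $E=\mathbb{F}_{q^s}$, let $\gamma$ be a primitive element of $E$, and let $C_0=\langle \gamma^N\rangle\le E^*$ and $C_i=\gamma^iC_0$ for $1\le i\le N-1$ (the cyclotomic classes of order $N$ of $E$, with $C_i$ depending only on $i \bmod N$). Let $I$ be any subset of $\mathbb{Z}/N\mathbb{Z}$ such that $\{i \bmod p_1^m \mid i\in I\}=\mathbb{Z}/p_1^m\mathbb{Z}$, and let $D=\bigcup_{i\in I}C_i$. Then $D$ is a skew Hadamard difference set in $(E,+)$ if $p\equiv 3\pmod 4$, and $D$ is a Paley type partial difference set in $(E,+)$ if $p\equiv 1\pmod 4$.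
   Context: For an abelian group $G$ (written additively) of order $v$, a $k$-subset $D$ is a $(v,k,\lambda)$ difference set if every nonzero element of $G$ is expressible as $x-y$ with $x,y\in D$ in exactly $\lambda$ ways. A difference set $D$ in $G$ is skew Hadamard if $G$ is the disjoint union of $D$, $-D=\{-d\mid d\in D\}$, and $\{0\}$. A $k$-subset $D$ of $G$ is a $(v,k,\lambda,\mu)$ partial difference set if the list of differences $x-y$ ($x,y\in D$, $x\ne y$) contains each nonzero element of $D$ exactly $\lambda$ times and each nonzero element of $G\setminus D$ exactly $\mu$ times. When $v\equiv 1\pmod 4$, a subset $D$ with $0\notin D$ is a Paley type partial difference set if it is a $(v,\frac{v-1}{2},\frac{v-5}{4},\frac{v-1}{4})$ partial difference set.
   Formalization: The subset I is also required to have exactly p_1^m elements (one per residue class mod p_1^m); otherwise I = Z/NZ gives D = E^*, for which the claim fails. *)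

theory Defs
  imports "HOL-Number_Theory.Number_Theory" "HOL-Algebra.Generated_Groups"
    "HOL-Library.Cardinality"
begin

text \<open>The group is the whole type \<open>'a\<close>, written additively.\<close>

definition difference_count :: "'a::ab_group_add set \<Rightarrow> 'a \<Rightarrow> nat" where
  "difference_count D g = card {(x, y). x \<in> D \<and> y \<in> D \<and> x - y = g}"

definition difference_set :: "nat \<Rightarrow> nat \<Rightarrow> nat \<Rightarrow> 'a::{ab_group_add,finite} set \<Rightarrow> bool" where
  "difference_set v k lam D \<longleftrightarrow>
     CARD('a) = v \<and> card D = k \<and> (\<forall>g. g \<noteq> 0 \<longrightarrow> difference_count D g = lam)"

definition skew_hadamard_difference_set :: "'a::{ab_group_add,finite} set \<Rightarrow> bool" where
  "skew_hadamard_difference_set D \<longleftrightarrow>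
     (\<exists>v k lam. difference_set v k lam D) \<and>
     UNIV = D \<union> uminus ` D \<union> {0} \<and>
     D \<inter> uminus ` D = {} \<and> 0 \<notin> D \<and> 0 \<notin> uminus ` D"

definition partial_difference_set ::
    "nat \<Rightarrow> nat \<Rightarrow> nat \<Rightarrow> nat \<Rightarrow> 'a::{ab_group_add,finite} set \<Rightarrow> bool" where
  "partial_difference_set v k lam mu D \<longleftrightarrow>
     CARD('a) = v \<and> card D = k \<and>
     (\<forall>g\<in>D. g \<noteq> 0 \<longrightarrow> difference_count D g = lam) \<and>
     (\<forall>g\<in>- D. g \<noteq> 0 \<longrightarrow> difference_count D g = mu)"

text \<open>
  The divisions are exact, except that \<open>(v - 5) div 4\<close> truncates for \<open>v = 1\<close>, where \<open>D\<close> is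
  empty and the parameter is not used.
\<close>

definition paley_type_pds :: "'a::{ab_group_add,finite} set \<Rightarrow> bool" where
  "paley_type_pds D \<longleftrightarrow>
     (let v = CARD('a) in
       v mod 4 = 1 \<and> 0 \<notin> D \<and>
       partial_difference_set v ((v - 1) div 2) ((v - 5) div 4) ((v - 1) div 4) D)"

definition primitive_element :: "'a::field \<Rightarrow> bool" where
  "primitive_element \<gamma> \<longleftrightarrow> \<gamma> \<noteq> 0 \<and> range (\<lambda>j::int. \<gamma> powi j) = UNIV - {0}"

definition cyclotomic_class :: "nat \<Rightarrow> 'a::field \<Rightarrow> nat \<Rightarrow> 'a set" where
  "cyclotomic_class N \<gamma> i = (\<lambda>x. \<gamma> ^ i * x) ` range (\<lambda>j::int. (\<gamma> ^ N) powi j)"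

abbreviation zmod_units :: "nat \<Rightarrow> int monoid" where
  "zmod_units N \<equiv> units_of (residue_ring (int N))"

definition gen_mod :: "nat \<Rightarrow> nat \<Rightarrow> int set" where
  "gen_mod N p = generate (zmod_units N) {int p mod int N}"

end

theory Submission
  imports Defs Complex_Main "HOL-Computational_Algebra.Polynomial"
begin

text \<open>
  Let \<open>\<chi>\<close> be the quadratic character of \<open>E\<close>, \<open>n = p1\<^sup>m\<close>, and \<open>H\<close> the group of \<open>n\<close>-th powers in \<open>E\<^sup>*\<close>.
  The Davenport--Hasse product formula expresses \<open>g(\<theta>\<chi>)\<close>, for \<open>\<theta>\<close> trivial on \<open>H\<close>, through
  \<open>g(\<theta>\<^sup>2) g(\<chi>) / g(\<theta>)\<close>. As \<open>p1\<close> is \<open>7\<close> modulo \<open>8\<close>, \<open>2\<close> is a square modulo \<open>n\<close>, hence a power of \<open>p\<close>, and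
  Frobenius gives \<open>g(\<theta>\<^sup>2) = g(\<theta>)\<close>; so all \<open>g(\<theta>\<chi>)\<close> equal \<open>g(\<chi>)\<close>. Equivalently, for the trace
  character \<open>\<psi>\<close>, the sum of \<open>\<chi> \<psi>\<close> over a coset of \<open>H\<close> vanishes unless the coset is \<open>H\<close> itself. The
  \<open>\<plusminus>1\<close>-valued function \<open>S\<close> of \<open>D\<close> is \<open>\<chi>\<close> times an \<open>H\<close>-invariant function, so every nontrivial Fourier
  coefficient of \<open>S\<close> is \<open>\<plusminus>g(\<chi>)\<close>, of squared modulus \<open>|E|\<close>, and Fourier inversion yields the
  difference counts. Multiplicative characters other than \<open>\<chi>\<close> are avoided by working with the
  Gauss periods of \<open>H\<close>: the product formula reduces to the evaluation of Salie sums.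
\<close>

section \<open>The trace character\<close>

text \<open>The polynomial \<open>X ^ p - X\<close> has at most \<open>p = CHAR('a)\<close> roots,
  and the \<open>p\<close> elements of the prime field are already roots. This places the values of
  the trace in the prime field.\<close>

lemma frobenius_fixed_iff:
  fixes x :: "'a::finite_field"
  shows "x ^ CHAR('a) = x \<longleftrightarrow> (\<exists>k. x = of_nat k)"
proof -
  let ?p = "CHAR('a)"
  have p: "prime ?p" by simp
  have p1: "1 < ?p" using prime_gt_1_nat[OF p] .
  define P where "P = monom (1::'a) ?p - monom 1 1"
  have "coeff P ?p = 1" using p1 by (simp add: P_def)
  then have P0: "P \<noteq> 0" by auto
  have degP: "degree P \<le> ?p"
    unfolding P_def using p1 by (intro degree_diff_le) (simp_all add: degree_monom_eq)
  have roots: "{x. poly P x = 0} = {x. x ^ ?p = x}"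
    by (auto simp: P_def poly_monom)
  have "of_nat k ^ ?p = (of_nat k :: 'a)" for k
    by (induction k) (use p1 in \<open>auto simp: freshmans_dream[OF p refl] power_0_left\<close>)
  then have sub: "range of_nat \<subseteq> {x::'a. x ^ ?p = x}" by auto
  have "card {x::'a. x ^ ?p = x} \<le> ?p"
    using card_poly_roots_bound[OF P0] degP roots by simp
  also have "?p = card ((of_nat :: nat \<Rightarrow> 'a) ` {..<?p})"
    by (subst card_image) (auto simp: inj_on_def of_nat_eq_iff_cong_CHAR cong_def)
  also have "\<dots> \<le> card (range (of_nat :: nat \<Rightarrow> 'a))"
    by (intro card_mono) auto
  finally have "range of_nat = {x::'a. x ^ ?p = x}"
    using sub by (intro card_seteq) auto
  then show ?thesis by auto
qed

text \<open>Given \<open>psi_add\<close> and \<open>psi_0\<close>, the condition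
  \<open>cnj_psi\<close> says that all values lie on the unit circle.\<close>

locale additive_character =
  fixes \<psi> :: "'a::finite_field \<Rightarrow> complex"
  assumes psi_add: "\<psi> (x + y) = \<psi> x * \<psi> y"
    and psi_0 [simp]: "\<psi> 0 = 1"
    and psi_nontrivial: "\<exists>x. \<psi> x \<noteq> 1"
    and cnj_psi: "cnj (\<psi> x) = \<psi> (- x)"
begin

text \<open>Orthogonality: for \<open>a \<noteq> 0\<close>, translation by \<open>t / a\<close>
  multiplies the sum by \<open>\<psi> t \<noteq> 1\<close>.\<close>

lemma sum_psi: "(\<Sum>x\<in>UNIV. \<psi> (a * x)) = (if a = 0 then of_nat CARD('a) else 0)"
proof (cases "a = 0")
  case False
  obtain t where t: "\<psi> t \<noteq> 1" using psi_nontrivial by blast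
  have "(\<Sum>x\<in>UNIV. \<psi> (a * x)) = (\<Sum>x\<in>UNIV. \<psi> (a * (x + t / a)))"
    by (rule sum.reindex_bij_witness[of _ "\<lambda>x. x + t / a" "\<lambda>x. x - t / a"]) auto
  also have "\<dots> = \<psi> t * (\<Sum>x\<in>UNIV. \<psi> (a * x))"
    using False by (simp add: distrib_left psi_add sum_distrib_left mult.commute)
  finally have "(1 - \<psi> t) * (\<Sum>x\<in>UNIV. \<psi> (a * x)) = 0"
    by (simp add: algebra_simps)
  then show ?thesis using t False by simp
qed simp

lemma sum_psi_nonzero:
  "(\<Sum>x\<in>-{0}. \<psi> (a * x)) = (if a = 0 then of_nat CARD('a) else 0) - 1"
proof -
  have "(\<Sum>x\<in>UNIV. \<psi> (a * x)) = \<psi> (a * 0) + (\<Sum>x\<in>-{0}. \<psi> (a * x))"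
    using sum.remove[of UNIV "0::'a" "\<lambda>x. \<psi> (a * x)"] by (simp add: Compl_eq_Diff_UNIV)
  then show ?thesis by (simp add: sum_psi)
qed

end

text \<open>The character is \<open>\<omega>\<close> to the absolute trace, for a primitive
  \<open>p\<close>-th root of unity \<open>\<omega>\<close>. Frobenius permutes the summands of the
  trace cyclically, whence the invariance.\<close>

lemma exists_frobenius_invariant_character:
  "\<exists>\<psi>::'a::finite_field \<Rightarrow> complex.
     additive_character \<psi> \<and> (\<forall>x. \<psi> (x ^ CHAR('a)) = \<psi> x)"
  if card: "CARD('a) = CHAR('a) ^ r"
proof -
  let ?p = "CHAR('a)"
  have p: "prime ?p" by simp
  have p1: "1 < ?p" using prime_gt_1_nat[OF p] .
  have "card {0::'a, 1} \<le> CARD('a)" by (intro card_mono) auto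
  then have "CARD('a) > 1" by simp
  then have r: "r > 0" using card by (cases r) auto
  define Tr where "Tr x = (\<Sum>i<r. x ^ (?p ^ i))" for x :: 'a
  have Tr_add: "Tr (x + y) = Tr x + Tr y" for x y
    by (simp add: Tr_def freshmans_dream'[OF p refl] sum.distrib)
  have Tr_pow: "Tr x ^ ?p = Tr (x ^ ?p)" for x
    by (simp add: Tr_def freshmans_dream_sum[OF p refl] mult.commute flip: power_mult)
  have Tr_frob: "Tr (x ^ ?p) = Tr x" for x
  proof -
    have "Tr (x ^ ?p) = (\<Sum>i<r. x ^ (?p ^ Suc i))"
      by (simp add: Tr_def flip: power_mult)
    also have "\<dots> = (\<Sum>i<Suc r. x ^ (?p ^ i)) - x"
      by (subst sum.lessThan_Suc_shift) simp
    also have "\<dots> = Tr x"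
      using finite_field_power_card_eq_same[of x] by (simp add: Tr_def card)
    finally show ?thesis .
  qed
  have "\<exists>k. Tr x = of_nat k" for x
    using frobenius_fixed_iff[of "Tr x"] by (simp add: Tr_pow Tr_frob)
  \<comment> \<open>\<open>k x\<close> is an arbitrary natural number representing
    \<open>Tr x\<close>; by \<open>om\<close> below, \<open>\<omega> ^ k x\<close> does not depend
    on the choice.\<close>
  then obtain k where k: "\<And>x. Tr x = of_nat (k x)"
    by metis
  define \<omega> where "\<omega> = cis (2 * pi / ?p)"
  have om_eq: "\<omega> ^ i = cis (2 * pi * real i / real ?p)" for i
    by (simp add: \<omega>_def Complex.DeMoivre mult_ac)
  have "\<omega> ^ ?p = 1"
    using p1 by (simp add: om_eq)
  then have om_mod: "\<omega> ^ i = \<omega> ^ (i mod ?p)" for i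
    using power_add[of \<omega> "i mod ?p" "?p * (i div ?p)"] by (simp add: power_mult)
  have om1: "\<omega> ^ i = 1 \<longleftrightarrow> ?p dvd i" for i
  proof -
    have "inj_on (\<lambda>k. cis (2 * pi * real k / real ?p)) {..<?p}"
      using bij_betw_roots_unity[of ?p] p1 by (simp add: bij_betw_def)
    then have "\<omega> ^ (i mod ?p) = \<omega> ^ 0 \<longleftrightarrow> i mod ?p = 0"
      using p1 unfolding om_eq by (intro inj_on_eq_iff) auto
    then show ?thesis using om_mod[of i] by (simp add: mod_eq_0_iff_dvd)
  qed
  have om: "\<omega> ^ i = \<omega> ^ j" if "(of_nat i :: 'a) = of_nat j" for i j
    using that om_mod[of i] om_mod[of j] by (simp add: of_nat_eq_iff_cong_CHAR cong_def)
  define \<psi> where "\<psi> x = \<omega> ^ k x" for x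
  have add: "\<psi> (x + y) = \<psi> x * \<psi> y" for x y
    unfolding \<psi>_def power_add[symmetric] by (rule om) (simp add: Tr_add flip: k)
  have "Tr 0 = 0" using p1 by (simp add: Tr_def power_0_left)
  then have psi0: "\<psi> 0 = 1"
    by (simp add: \<psi>_def om1 k of_nat_eq_0_iff_char_dvd)
  have cnj: "cnj (\<psi> x) = \<psi> (- x)" for x
  proof -
    have "\<psi> x * \<psi> (- x) = 1" using add[of x "- x"] psi0 by simp
    moreover have "\<psi> x * cnj (\<psi> x) = 1"
      by (simp add: \<psi>_def \<omega>_def cis_cnj cis_mult flip: power_mult_distrib)
    ultimately show ?thesis by (metis mult_cancel_left mult_zero_left zero_neq_one)
  qed
  \<comment> \<open>Otherwise a nonzero polynomial of degree at most \<open>p ^ (r - 1)\<close>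
    would vanish on all \<open>p ^ r\<close> elements.\<close>
  have "\<exists>x. Tr x \<noteq> 0"
  proof (rule ccontr)
    assume none: "\<not> (\<exists>x. Tr x \<noteq> 0)"
    define P where "P = (\<Sum>i<r. monom (1::'a) (?p ^ i))"
    have "poly P x = Tr x" for x
      by (simp add: P_def Tr_def poly_sum poly_monom)
    then have "{x. poly P x = 0} = UNIV" using none by auto
    moreover have "coeff P (?p ^ (r - 1)) = (\<Sum>i<r. if i = r - 1 then 1 else 0)"
      unfolding P_def coeff_sum using p1 by (intro sum.cong) auto
    then have "P \<noteq> 0" using r by auto
    ultimately have "CARD('a) \<le> degree P"
      using card_poly_roots_bound[of P] by simp
    also have "degree P \<le> ?p ^ (r - 1)"
      unfolding P_def using p1
      by (intro degree_sum_le) (auto simp: degree_monom_eq intro!: power_increasing)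
    also have "\<dots> < CARD('a)"
      unfolding card using p1 r by (intro power_strict_increasing) auto
    finally show False by simp
  qed
  then have nontriv: "\<exists>x. \<psi> x \<noteq> 1"
    by (simp add: \<psi>_def om1 k of_nat_eq_0_iff_char_dvd)
  have "\<psi> (x ^ ?p) = \<psi> x" for x
    unfolding \<psi>_def by (rule om) (simp add: Tr_frob flip: k)
  with add psi0 cnj nontriv show ?thesis
    by (intro exI[of _ \<psi>]) (simp add: additive_character_def)
qed

section \<open>The quadratic Gauss sum and Salie sums\<close>

lemma power_card_minus_one:
  fixes x :: "'a::finite_field"
  assumes "x \<noteq> 0"
  shows "x ^ (CARD('a) - 1) = 1"
proof -
  have "x * x ^ (CARD('a) - 1) = x * 1"
    using finite_field_power_card_eq_same[of x] zero_less_card_finite[where ?'a='a]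
    by (simp flip: power_Suc)
  then show ?thesis using assms by simp
qed

lemma primitive_element_power_exists:
  fixes \<gamma> x :: "'a::finite_field"
  assumes "primitive_element \<gamma>" and "x \<noteq> 0"
  obtains t where "t < CARD('a) - 1" and "x = \<gamma> ^ t"
proof -
  define k where "k = CARD('a) - 1"
  have g0: "\<gamma> \<noteq> 0" using assms by (simp add: primitive_element_def)
  have "card {0::'a, 1} \<le> CARD('a)" by (intro card_mono) auto
  then have k: "k > 0" by (simp add: k_def)
  have "x \<in> range (\<lambda>j::int. \<gamma> powi j)" using assms by (auto simp: primitive_element_def)
  then obtain j :: int where j: "x = \<gamma> powi j" by blast
  have "x = \<gamma> powi (j mod int k + int k * (j div int k))" by (simp add: j)
  also have "\<dots> = \<gamma> powi (j mod int k) * (\<gamma> powi int k) powi (j div int k)"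
    using g0 by (simp only: power_int_add power_int_mult simp_thms)
  also have "\<gamma> powi int k = 1"
    using power_card_minus_one[OF g0] by (simp add: k_def del: of_nat_diff)
  also have "\<gamma> powi (j mod int k) = \<gamma> ^ nat (j mod int k)"
    using k by (simp add: power_int_def)
  finally have "x = \<gamma> ^ nat (j mod int k)" by simp
  moreover have "nat (j mod int k) < k" using k by (simp add: nat_less_iff)
  ultimately show ?thesis using that by (simp add: k_def)
qed

text \<open>The exponents below \<open>CARD('a) - 1\<close> reach every nonzero element, and there
  are as many exponents as elements, so none is reached twice.\<close>

lemma primitive_element_power_eq_iff:
  fixes \<gamma> :: "'a::finite_field"
  assumes "primitive_element \<gamma>"
  shows "\<gamma> ^ a = \<gamma> ^ b \<longleftrightarrow> [a = b] (mod (CARD('a) - 1))"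
proof -
  let ?k = "CARD('a) - 1"
  have g0: "\<gamma> \<noteq> 0" using assms by (simp add: primitive_element_def)
  have "card {0::'a, 1} \<le> CARD('a)" by (intro card_mono) auto
  then have k: "?k > 0" by simp
  have "(\<lambda>t. \<gamma> ^ t) ` {..<?k} = UNIV - {0}"
  proof (intro equalityI subsetI)
    fix x assume "x \<in> UNIV - {0::'a}"
    then have "x \<noteq> 0" by simp
    then obtain t where "t < ?k" "x = \<gamma> ^ t"
      by (rule primitive_element_power_exists[OF assms])
    then show "x \<in> (\<lambda>t. \<gamma> ^ t) ` {..<?k}" by blast
  qed (use g0 in auto)
  then have "card ((\<lambda>t. \<gamma> ^ t) ` {..<?k}) = card {..<?k}"
    by (simp add: card_Diff_subset)
  then have inj: "inj_on (\<lambda>t. \<gamma> ^ t) {..<?k}" by (intro eq_card_imp_inj_on) auto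
  have md: "\<gamma> ^ t = \<gamma> ^ (t mod ?k)" for t
    using power_add[of \<gamma> "t mod ?k" "?k * (t div ?k)"] power_card_minus_one[OF g0]
    by (simp add: power_mult)
  show ?thesis
    using inj_onD[OF inj, of "a mod ?k" "b mod ?k"] md[of a] md[of b] k
    by (auto simp: cong_def)
qed

section \<open>The quadratic character and its Gauss sum\<close>

definition quadratic_character :: "'a::field \<Rightarrow> complex" where
  "quadratic_character x = (if x = 0 then 0 else if \<exists>y. x = y\<^sup>2 then 1 else - 1)"

lemma quadratic_character_0 [simp]: "quadratic_character 0 = 0"
  by (simp add: quadratic_character_def)

lemma quadratic_character_1 [simp]: "quadratic_character 1 = 1"
  by (auto simp: quadratic_character_def intro: exI[of _ 1])

lemma quadratic_character_square: "x \<noteq> 0 \<Longrightarrow> quadratic_character (x\<^sup>2) = 1"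
  by (auto simp: quadratic_character_def)

lemma quadratic_character_cases:
  "x \<noteq> 0 \<Longrightarrow> quadratic_character x = 1 \<or> quadratic_character x = - 1"
  by (simp add: quadratic_character_def)

text \<open>Exponents matter modulo the even number \<open>CARD('a) - 1\<close>, so their parity is
  well defined, and the nonzero squares are the even powers of \<open>\<gamma>\<close>.\<close>

lemma quadratic_character_power_primitive:
  fixes \<gamma> :: "'a::finite_field"
  assumes prim: "primitive_element \<gamma>" and odd: "odd CARD('a)"
  shows "quadratic_character (\<gamma> ^ t) = (- 1) ^ t"
proof -
  have g0: "\<gamma> \<noteq> 0" using prim by (simp add: primitive_element_def)
  have "(\<exists>y. \<gamma> ^ t = y\<^sup>2) \<longleftrightarrow> even t"
  proof
    assume "\<exists>y. \<gamma> ^ t = y\<^sup>2"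
    then obtain y where y: "\<gamma> ^ t = y\<^sup>2" by blast
    then have "y \<noteq> 0" using g0 by auto
    then obtain u where "y = \<gamma> ^ u" using primitive_element_power_exists[OF prim] by blast
    then have "\<gamma> ^ t = \<gamma> ^ (2 * u)" using y by (simp add: power_mult mult.commute)
    then have "[t = 2 * u] (mod (CARD('a) - 1))"
      using primitive_element_power_eq_iff[OF prim] by blast
    then have "[t = 2 * u] (mod 2)" using odd by (auto intro: cong_dvd_modulus_nat)
    then show "even t" by (simp add: cong_def even_iff_mod_2_eq_zero)
  next
    assume "even t"
    then obtain u where "t = 2 * u" by blast
    then show "\<exists>y. \<gamma> ^ t = y\<^sup>2" by (intro exI[of _ "\<gamma> ^ u"]) (simp add: power_mult mult.commute)
  qed
  then show ?thesis using g0 by (simp add: quadratic_character_def)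
qed

lemma quadratic_character_mult:
  fixes \<gamma> :: "'a::finite_field"
  assumes prim: "primitive_element \<gamma>" and odd: "odd CARD('a)"
  shows "quadratic_character (x * y :: 'a) = quadratic_character x * quadratic_character y"
proof (cases "x = 0 \<or> y = 0")
  case False
  then obtain a b where "x = \<gamma> ^ a" "y = \<gamma> ^ b"
    using primitive_element_power_exists[OF prim] by metis
  then show ?thesis
    using quadratic_character_power_primitive[OF assms] by (simp flip: power_add)
qed auto

locale quadratic_gauss_sum = additive_character \<psi>
  for \<psi> :: "'a::finite_field \<Rightarrow> complex" +
  assumes odd_card: "odd CARD('a)"
    and primitive: "\<exists>\<gamma>::'a. primitive_element \<gamma>"
begin

abbreviation \<chi> :: "'a \<Rightarrow> complex" where "\<chi> \<equiv> quadratic_character"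

lemma chi_mult: "\<chi> (x * y) = \<chi> x * \<chi> y"
  using primitive quadratic_character_mult odd_card by blast

lemma chi_power: "\<chi> (x ^ k) = \<chi> x ^ k"
  by (induction k) (simp_all add: chi_mult)

lemma chi_nonzero [simp]: "x \<noteq> 0 \<Longrightarrow> \<chi> x \<noteq> 0"
  using quadratic_character_cases[of x] by auto

lemma chi_mult_self: "x \<noteq> 0 \<Longrightarrow> \<chi> x * \<chi> x = 1"
  using quadratic_character_cases[of x] by auto

lemma cnj_chi [simp]: "cnj (\<chi> x) = \<chi> x"
  by (simp add: quadratic_character_def)

lemma chi_inverse: "\<chi> (inverse x) = \<chi> x"
proof (cases "x = 0")
  case False
  have "\<chi> x * \<chi> (inverse x) = \<chi> x * \<chi> x"
    using False chi_mult[of x "inverse x"] chi_mult_self[of x] by simp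
  then show ?thesis using False by simp
qed simp

lemma chi_divide: "\<chi> (x / y) = \<chi> x * \<chi> y"
  by (simp add: divide_inverse chi_mult chi_inverse)

lemma two_neq_0: "(2::'a) \<noteq> 0"
proof
  assume "(2::'a) = 0"
  then have "CHAR('a) dvd 2"
    by (metis of_nat_eq_0_iff_char_dvd of_nat_numeral)
  then have "CHAR('a) = 2"
    using primes_dvd_imp_eq[of "CHAR('a)" 2] by simp
  then show False using CHAR_dvd_CARD[where ?'a='a] odd_card by simp
qed

lemma chi_4_mult: "\<chi> (4 * x) = \<chi> x"
  using chi_mult[of "2 * 2" x] chi_mult[of 2 2] chi_mult_self[OF two_neq_0] by simp

lemma exists_chi_minus_one: "\<exists>x. \<chi> x = - 1"
  using primitive quadratic_character_power_primitive[OF _ odd_card, of _ 1] by auto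

text \<open>Multiplying the variable by a nonsquare \<open>u\<close> reverses the sign of the
  sum.\<close>

lemma sum_chi: "(\<Sum>x\<in>UNIV. \<chi> x) = 0"
proof -
  obtain u where u: "\<chi> u = - 1" using exists_chi_minus_one by blast
  then have u0: "u \<noteq> 0" by auto
  have "(\<Sum>x\<in>UNIV. \<chi> x) = (\<Sum>x\<in>UNIV. \<chi> (u * x))"
    by (rule sum.reindex_bij_witness[of _ "\<lambda>x. u * x" "\<lambda>x. x / u"]) (use u0 in auto)
  also have "\<dots> = - (\<Sum>x\<in>UNIV. \<chi> x)"
    by (simp add: chi_mult u sum_negf)
  finally show ?thesis by simp
qed

text \<open>The quadratic Gauss sum, written \<open>g(\<chi>)\<close> in the introduction.\<close>

definition Q :: complex where "Q = (\<Sum>x\<in>UNIV. \<chi> x * \<psi> x)"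

lemma Q_nonzero_sum: "Q = (\<Sum>x\<in>-{0}. \<chi> x * \<psi> x)"
  unfolding Q_def by (rule sum.mono_neutral_right) auto

text \<open>Substituting \<open>x = u * y\<close> and summing over \<open>y\<close> first,
  orthogonality leaves the term \<open>u = 1\<close> and a multiple of
  \<open>sum_chi\<close>.\<close>

lemma Q_mult_cnj: "Q * cnj Q = of_nat CARD('a)"
proof -
  have "Q * cnj Q = (\<Sum>y\<in>-{0}. \<Sum>x\<in>UNIV. \<chi> x * \<psi> x * (\<chi> y * \<psi> (- y)))"
    unfolding Q_def by (subst (2) Q_nonzero_sum[unfolded Q_def], subst sum.swap)
      (simp add: sum_product cnj_psi)
  also have "\<dots> = (\<Sum>y\<in>-{0}. \<Sum>u\<in>UNIV. \<chi> u * \<psi> ((u - 1) * y))"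
  proof (rule sum.cong[OF refl])
    fix y :: 'a assume "y \<in> - {0}"
    then have y: "y \<noteq> 0" by simp
    have "(\<Sum>x\<in>UNIV. \<chi> x * \<psi> x * (\<chi> y * \<psi> (- y)))
        = (\<Sum>u\<in>UNIV. \<chi> (u * y) * \<psi> (u * y) * (\<chi> y * \<psi> (- y)))"
      by (rule sum.reindex_bij_witness[of _ "\<lambda>u. u * y" "\<lambda>x. x / y"]) (use y in auto)
    also have "\<dots> = (\<Sum>u\<in>UNIV. \<chi> u * \<psi> ((u - 1) * y))"
    proof (rule sum.cong[OF refl])
      fix u
      have "\<psi> (u * y) * \<psi> (- y) = \<psi> ((u - 1) * y)"
        by (simp add: left_diff_distrib flip: psi_add)
      then show "\<chi> (u * y) * \<psi> (u * y) * (\<chi> y * \<psi> (- y)) = \<chi> u * \<psi> ((u - 1) * y)"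
        using chi_mult_self[OF y] by (simp add: chi_mult mult_ac)
    qed
    finally show "(\<Sum>x\<in>UNIV. \<chi> x * \<psi> x * (\<chi> y * \<psi> (- y)))
        = (\<Sum>u\<in>UNIV. \<chi> u * \<psi> ((u - 1) * y))" .
  qed
  also have "\<dots> = (\<Sum>u\<in>UNIV. \<chi> u * (\<Sum>y\<in>-{0}. \<psi> ((u - 1) * y)))"
    by (subst sum.swap) (simp add: sum_distrib_left)
  also have "\<dots> = (\<Sum>u\<in>UNIV. (if u = 1 then \<chi> u * of_nat CARD('a) else 0) - \<chi> u)"
    unfolding sum_psi_nonzero by (rule sum.cong) (auto simp: algebra_simps)
  also have "\<dots> = of_nat CARD('a)"
    by (simp add: sum_subtractf sum_chi)
  finally show ?thesis .
qed

section \<open>Square roots, quadratic equations and Salie sums\<close>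

lemma card_square_roots:
  assumes "x \<noteq> 0"
  shows "of_nat (card {d. d\<^sup>2 = x}) = 1 + \<chi> x"
proof (cases "\<exists>d. x = d\<^sup>2")
  case True
  then obtain d where d: "x = d\<^sup>2" by blast
  then have "d \<noteq> 0" using assms by auto
  then have "d \<noteq> - d" using two_neq_0 by (simp add: eq_neg_iff_add_eq_0 flip: mult_2)
  moreover have "{e. e\<^sup>2 = x} = {d, - d}" by (auto simp: d power2_eq_iff)
  ultimately show ?thesis using True assms by (simp add: quadratic_character_def)
next
  case False
  then have "{d. d\<^sup>2 = x} = {}" by auto
  then show ?thesis using False assms by (simp add: quadratic_character_def)
qed

lemma chi_eq_of_mult_square: "\<chi> x = \<chi> y" if "x * y = w\<^sup>2" "w \<noteq> 0"
proof -
  have "\<chi> x * \<chi> y = 1" using quadratic_character_square[OF that(2)] that(1) by (simp flip: chi_mult)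
  moreover from this have "x \<noteq> 0" "y \<noteq> 0" by auto
  ultimately show ?thesis using quadratic_character_cases[of x] quadratic_character_cases[of y] by auto
qed

text \<open>
  If \<open>x\<^sup>2 - z x + d\<^sup>2 = 0\<close>, then \<open>x (z \<plusminus> 2 d) = (x \<plusminus> d)\<^sup>2\<close>.
\<close>

lemma sum_chi_quadratic_roots:
  assumes d: "d \<noteq> 0"
  shows "(\<Sum>x | x \<noteq> 0 \<and> x + d\<^sup>2 / x = z. \<chi> x) = \<chi> (z + 2 * d) + \<chi> (z - 2 * d)"
proof -
  let ?R = "{x. x \<noteq> 0 \<and> x + d\<^sup>2 / x = z}"
  \<comment> \<open>The discriminant \<open>z\<^sup>2 - 4 * d\<^sup>2\<close> of the quadratic
    equation, in factored form.\<close>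
  define \<Delta> where "\<Delta> = (z + 2 * d) * (z - 2 * d)"
  have R_iff: "x \<in> ?R \<longleftrightarrow> x\<^sup>2 + d\<^sup>2 = z * x" for x
    using d by (cases "x = 0") (simp_all add: field_simps power2_eq_square)
  have R_disc: "x \<in> ?R \<longleftrightarrow> (2 * x - z)\<^sup>2 = \<Delta>" for x
  proof -
    have "(2 * x - z)\<^sup>2 - \<Delta> = 4 * (x\<^sup>2 + d\<^sup>2 - z * x)"
      by (simp add: \<Delta>_def power2_eq_square algebra_simps)
    moreover have "(4::'a) \<noteq> 0" using two_neq_0 by (metis mult_2 mult_eq_0_iff numeral_Bit0 numeral_plus_numeral)
    ultimately show ?thesis unfolding R_iff by (metis eq_iff_diff_eq_0 mult_eq_0_iff)
  qed
  have card_R: "card ?R = card {w. w\<^sup>2 = \<Delta>}"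
  proof (rule bij_betw_same_card)
    have inv: "2 * ((w + z) / 2) - z = w" for w
      by (simp only: times_divide_eq_right nonzero_mult_div_cancel_left[OF two_neq_0]
          add_diff_cancel_right')
    have "(w + z) / 2 \<in> ?R" if "w\<^sup>2 = \<Delta>" for w
      using that unfolding R_disc inv .
    then show "bij_betw (\<lambda>x. 2 * x - z) ?R {w. w\<^sup>2 = \<Delta>}"
      using two_neq_0 R_disc inv by (intro bij_betw_byWitness[of _ "\<lambda>w. (w + z) / 2"]) auto
  qed
  \<comment> \<open>If \<open>\<Delta> = 0\<close>, there is one double root, \<open>d\<close> or
    \<open>- d\<close>, and one of the two terms on the right is
    \<open>\<chi> 0 = 0\<close>.\<close>
  consider "z = 2 * d" | "z = - 2 * d" | "\<Delta> \<noteq> 0"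
    by (auto simp: \<Delta>_def eq_neg_iff_add_eq_0)
  then show ?thesis
  proof cases
    case 1
    have "x \<in> ?R \<longleftrightarrow> x = d" for x
    proof -
      have "x\<^sup>2 + d\<^sup>2 - z * x = (x - d)\<^sup>2" by (simp add: 1 power2_eq_square algebra_simps)
      then show ?thesis unfolding R_iff by (metis eq_iff_diff_eq_0 power_eq_0_iff zero_power2)
    qed
    then have "?R = {d}" by blast
    moreover have "z + 2 * d = 4 * d" "z - 2 * d = 0" by (simp_all add: 1)
    ultimately show ?thesis by (simp add: chi_4_mult)
  next
    case 2
    have "x \<in> ?R \<longleftrightarrow> x = - d" for x
    proof -
      have "x\<^sup>2 + d\<^sup>2 - z * x = (x + d)\<^sup>2" by (simp add: 2 power2_eq_square algebra_simps)
      then show ?thesis unfolding R_iff by (metis eq_iff_diff_eq_0 eq_neg_iff_add_eq_0 power_eq_0_iff zero_power2)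
    qed
    then have "?R = {- d}" by blast
    moreover have "z + 2 * d = 0" by (simp add: 2)
    moreover have "z - 2 * d = 4 * (- d)" by (simp add: 2)
    then have "\<chi> (z - 2 * d) = \<chi> (- d)" by (simp only: chi_4_mult)
    ultimately show ?thesis by simp
  next
    case 3
    then have nz: "z + 2 * d \<noteq> 0" "z - 2 * d \<noteq> 0" by (auto simp: \<Delta>_def)
    have cRC: "of_nat (card ?R) = 1 + \<chi> \<Delta>" using card_square_roots[OF 3] card_R by simp
    have plus: "\<chi> x = \<chi> (z + 2 * d)" if "x \<in> ?R" for x
    proof -
      have "x * (z + 2 * d) = (x + d)\<^sup>2"
        using that unfolding R_iff by (simp add: power2_eq_square algebra_simps)
      moreover have "x \<noteq> 0" using that by simp
      ultimately show ?thesis using nz by (intro chi_eq_of_mult_square[of _ _ "x + d"]) auto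
    qed
    \<comment> \<open>All roots have the same \<open>\<chi>\<close>, so the sum is their number
      \<open>1 + \<chi> \<Delta>\<close> times that value; multiplying out restores the symmetry in
      \<open>d\<close> and \<open>- d\<close>.\<close>
    have "(\<Sum>x\<in>?R. \<chi> x) = (\<Sum>x\<in>?R. \<chi> (z + 2 * d))" using plus by (rule sum.cong[OF refl])
    also have "\<dots> = (1 + \<chi> \<Delta>) * \<chi> (z + 2 * d)" by (simp only: sum_constant cRC)
    also have "\<dots> = \<chi> (z + 2 * d) + \<chi> (z + 2 * d) * \<chi> (z + 2 * d) * \<chi> (z - 2 * d)"
      unfolding \<Delta>_def chi_mult[of "z + 2 * d"] by (subst distrib_right) (simp only: mult_ac mult_1)
    also have "\<dots> = \<chi> (z + 2 * d) + \<chi> (z - 2 * d)"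
      using chi_mult_self[OF nz(1)] by simp
    finally show ?thesis .
  qed
qed

text \<open>Group the terms by \<open>z = y + d\<^sup>2 / y\<close>. Each fibre sum is known from
  \<open>sum_chi_quadratic_roots\<close>, and summing over \<open>z\<close> gives two translated
  copies of \<open>Q\<close>.\<close>

lemma salie_sum:
  assumes d: "d \<noteq> 0"
  shows "(\<Sum>y\<in>-{0}. \<chi> y * \<psi> (y + d\<^sup>2 / y)) = Q * (\<psi> (2 * d) + \<psi> (- 2 * d))"
proof -
  have shift: "(\<Sum>z\<in>UNIV. \<psi> z * \<chi> (z + c)) = \<psi> (- c) * Q" for c
  proof -
    have "(\<Sum>z\<in>UNIV. \<psi> z * \<chi> (z + c)) = (\<Sum>w\<in>UNIV. \<psi> (w - c) * \<chi> w)"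
      by (rule sum.reindex_bij_witness[of _ "\<lambda>w. w - c" "\<lambda>z. z + c"]) auto
    also have "\<dots> = \<psi> (- c) * Q"
      using psi_add[of _ "- c"] by (simp add: Q_def sum_distrib_left mult_ac)
    finally show ?thesis .
  qed
  have "(\<Sum>y\<in>-{0}. \<chi> y * \<psi> (y + d\<^sup>2 / y))
      = (\<Sum>z\<in>UNIV. \<Sum>y | y \<in> - {0} \<and> y + d\<^sup>2 / y = z. \<chi> y * \<psi> (y + d\<^sup>2 / y))"
    by (rule sum.group[symmetric]) auto
  also have "\<dots> = (\<Sum>z\<in>UNIV. \<psi> z * (\<chi> (z + 2 * d) + \<chi> (z - 2 * d)))"
  proof (rule sum.cong[OF refl])
    fix z
    have "(\<Sum>y | y \<in> - {0} \<and> y + d\<^sup>2 / y = z. \<chi> y * \<psi> (y + d\<^sup>2 / y))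
        = \<psi> z * (\<Sum>y | y \<noteq> 0 \<and> y + d\<^sup>2 / y = z. \<chi> y)"
      unfolding sum_distrib_left by (rule sum.cong) auto
    then show "(\<Sum>y | y \<in> - {0} \<and> y + d\<^sup>2 / y = z. \<chi> y * \<psi> (y + d\<^sup>2 / y))
        = \<psi> z * (\<chi> (z + 2 * d) + \<chi> (z - 2 * d))"
      by (simp add: sum_chi_quadratic_roots[OF d])
  qed
  also have "\<dots> = Q * (\<psi> (2 * d) + \<psi> (- 2 * d))"
    using shift[of "2 * d"] shift[of "- (2 * d)"]
    by (simp add: distrib_left sum.distrib mult.commute)
  finally show ?thesis .
qed

end

section \<open>Gauss sums over cosets of the subgroup of powers\<close>

text \<open>
  The assumption \<open>two_power\<close> puts \<open>2\<close> into the group generated by \<open>CHAR('a)\<close> modulo \<open>n\<close>, so that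
  squaring and a power of Frobenius agree modulo \<open>n\<close>-th powers.
\<close>

locale two_frobenius = quadratic_gauss_sum \<psi>
  for \<psi> :: "'a::finite_field \<Rightarrow> complex" +
  fixes n j l :: nat
  assumes frobenius: "\<psi> (x ^ CHAR('a)) = \<psi> x"
    and odd_n: "odd n"
    and two_power: "CHAR('a) ^ j = 2 + n * l"
begin

section \<open>The group of powers and its Gauss periods\<close>

definition H :: "'a set" where "H = (\<lambda>y. y ^ n) ` (- {0})"

lemma powerH: "y \<noteq> 0 \<Longrightarrow> y ^ n \<in> H"
  by (simp add: H_def)

lemma H_nonzero: "x \<in> H \<Longrightarrow> x \<noteq> 0"
  by (auto simp: H_def)

lemma one_H: "1 \<in> H"
  using powerH[of 1] by simp

lemma mult_H: "x \<in> H \<Longrightarrow> y \<in> H \<Longrightarrow> x * y \<in> H"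
  unfolding H_def by (auto simp flip: power_mult_distrib)

lemma power_H: "x \<in> H \<Longrightarrow> x ^ k \<in> H"
  by (induction k) (simp_all add: one_H mult_H)

lemma inverse_H: "x \<in> H \<Longrightarrow> inverse x \<in> H"
  unfolding H_def by (auto simp flip: power_inverse)

lemma divide_H: "x \<in> H \<Longrightarrow> y \<in> H \<Longrightarrow> x / y \<in> H"
  by (simp add: divide_inverse mult_H inverse_H)

lemma mult_H_iff: "x * y \<in> H \<longleftrightarrow> y \<in> H" if "x \<in> H"
  using mult_H[OF that] mult_H[OF inverse_H[OF that], of "x * y"] H_nonzero[OF that]
  by (auto simp flip: mult.assoc)

lemma mult_H_iff': "y * x \<in> H \<longleftrightarrow> y \<in> H" if "x \<in> H"
  using mult_H_iff[OF that, of y] by (simp only: mult.commute)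

lemma uminus_H: "x \<in> H \<Longrightarrow> - x \<in> H"
  unfolding H_def using odd_n by (auto intro!: image_eqI[of _ _ "- _"])

text \<open>As \<open>n\<close> is odd, \<open>d ^ n * d\<close> is a power of
  \<open>d\<^sup>2\<close>, while \<open>d ^ n\<close> lies in \<open>H\<close>.\<close>

lemma square_in_H_iff: "d\<^sup>2 \<in> H \<longleftrightarrow> d \<in> H"
proof
  assume d2: "d\<^sup>2 \<in> H"
  then have d: "d \<noteq> 0" using H_nonzero by fastforce
  obtain k where k: "n = 2 * k + 1" using odd_n by (elim oddE)
  have "d ^ n * d = (d ^ Suc k)\<^sup>2" by (simp add: k power2_eq_square power_add mult_2)
  also have "\<dots> = (d\<^sup>2) ^ Suc k" by (simp only: mult.commute flip: power_mult)
  also have "\<dots> \<in> H" using d2 by (rule power_H)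
  finally show "d \<in> H" using mult_H_iff[OF powerH[OF d]] by simp
qed (simp add: power2_eq_square mult_H)

text \<open>Frobenius fixes \<open>2\<close>, so \<open>two_power\<close> gives
  \<open>2 ^ (2 + n * l) = 2\<close>; hence \<open>2\<close> is inverse to the \<open>n\<close>-th
  power of \<open>2 ^ l\<close>.\<close>

lemma two_in_H: "2 \<in> H"
proof -
  have "(2::'a) ^ CHAR('a) ^ i = 2" for i
  proof (induction i)
    case (Suc i)
    have "(2::'a) ^ CHAR('a) = 2"
      using frobenius_fixed_iff[of "2::'a"] of_nat_numeral[of "num.Bit0 num.One", where ?'a = 'a] by metis
    then show ?case using Suc by (simp add: power_mult)
  qed simp
  then have "(2::'a) ^ (2 + n * l) = 2" by (metis two_power)
  then have "2 * (2 * (2 ^ l) ^ n) = (2 * 1 :: 'a)"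
    by (simp add: power_add power2_eq_square power_mult mult_ac flip: power_mult)
  then have "2 * (2 ^ l) ^ n = (1 :: 'a)" using two_neq_0 mult_left_cancel by blast
  then have "(2::'a) * (2 ^ l) ^ n \<in> H" using one_H by simp
  then show ?thesis using mult_H_iff'[OF powerH, of "2 ^ l" 2] two_neq_0 by simp
qed

text \<open>For \<open>b \<noteq> 0\<close> this is the Gauss period of the coset
  \<open>b H\<close>.\<close>

definition h :: "'a \<Rightarrow> complex" where "h b = (\<Sum>x\<in>H. \<psi> (b * x))"

lemma h_mult_H: "h (b * a) = h b" if "a \<in> H"
  unfolding h_def
  by (rule sum.reindex_bij_witness[of _ "\<lambda>x. x / a" "\<lambda>x. a * x"])
    (use that H_nonzero in \<open>auto simp: mult_H divide_H mult_ac\<close>)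

lemma h_mult_H': "h (a * b) = h b" if "a \<in> H"
  using h_mult_H[OF that, of b] by (simp only: mult.commute)

text \<open>Frobenius permutes \<open>H\<close> and leaves \<open>\<psi>\<close> unchanged.\<close>

lemma h_frobenius: "h (b ^ CHAR('a)) = h b"
proof -
  let ?F = "\<lambda>x::'a. x ^ CHAR('a)"
  have inj: "inj ?F"
  proof (rule injI)
    fix x y :: 'a assume "?F x = ?F y"
    then have "(x - y) ^ CHAR('a) + ?F y = ?F y"
      using freshmans_dream[OF CHAR_prime refl, of "x - y" y] by simp
    then show "x = y" by simp
  qed
  then have injH: "inj_on ?F H" by (rule inj_on_subset) simp
  have "?F ` H \<subseteq> H"
    by (auto simp: H_def mult.commute intro!: image_eqI[of _ _ "_ ^ CHAR('a)"] simp flip: power_mult)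
  then have "?F ` H = H"
    using injH by (intro card_subset_eq) (auto simp: card_image)
  then have "h (b ^ CHAR('a)) = (\<Sum>x\<in>?F ` H. \<psi> (b ^ CHAR('a) * x))" by (simp add: h_def)
  also have "\<dots> = (\<Sum>x\<in>H. \<psi> ((b * x) ^ CHAR('a)))"
    using injH by (subst sum.reindex) (auto simp: power_mult_distrib)
  finally show ?thesis by (simp add: frobenius h_def)
qed

text \<open>Applying Frobenius \<open>j\<close> times turns \<open>b\<close> into
  \<open>b\<^sup>2 * (b ^ l) ^ n\<close>, which lies in the coset of \<open>b\<^sup>2\<close>. For
  periods this plays the part of \<open>g(\<theta>\<^sup>2) = g(\<theta>)\<close>.\<close>

lemma h_square: "h (b\<^sup>2) = h b" if "b \<noteq> 0"
proof -
  have "h (b ^ CHAR('a) ^ i) = h b" for i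
    by (induction i) (simp_all add: h_frobenius power_mult mult.commute[of "CHAR('a)"])
  then have "h b = h (b\<^sup>2 * (b ^ l) ^ n)"
    by (metis mult.commute power_add power_mult two_power)
  then show ?thesis using that h_mult_H[OF powerH, of "b ^ l"] by simp
qed

text \<open>As \<open>n\<close> is odd, \<open>c ^ n * c\<close> is a square, so squaring is onto
  modulo \<open>H\<close>.\<close>

lemma eq_square_mult_H:
  assumes "c \<noteq> 0"
  obtains b a where "b \<noteq> 0" "a \<in> H" "c = b\<^sup>2 * a"
proof -
  obtain k where k: "n = 2 * k + 1" using odd_n by (elim oddE)
  have "c ^ n * c = (c ^ Suc k)\<^sup>2" by (simp add: k power2_eq_square power_add mult_2)
  then have "c = (c ^ Suc k)\<^sup>2 * inverse (c ^ n)" using assms by (simp add: field_simps)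
  moreover have "inverse (c ^ n) \<in> H" using assms by (intro inverse_H powerH)
  ultimately show ?thesis using that[of "c ^ Suc k" "inverse (c ^ n)"] assms by simp
qed

text \<open>
  A group-ring form of the product formula
  \<open>g(\<theta>) g(\<theta>\<chi>) = \<theta>(4)\<inverse> g(\<theta>\<^sup>2) g(\<chi>)\<close> of Davenport and Hasse, combined over all characters
  \<open>\<theta>\<close> trivial on \<open>H\<close>.
\<close>

lemma davenport_hasse_square:
  assumes b: "b \<noteq> 0"
  shows "(\<Sum>y\<in>-{0}. \<chi> y * \<psi> y * h (b\<^sup>2 / y)) = Q * h (2 * b)"
proof -
  \<comment> \<open>The sums \<open>K x\<close> over \<open>x \<in> H\<close> add up to the
    left-hand side; at a square \<open>x = d\<^sup>2\<close> they are the Salie sums evaluated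
    above.\<close>
  define K where "K x = (\<Sum>y\<in>-{0}. \<chi> y * \<psi> (y + b\<^sup>2 * x / y))" for x
  \<comment> \<open>The involution \<open>y \<mapsto> b\<^sup>2 * x / y\<close> multiplies the sum
    by \<open>\<chi> x\<close>, so \<open>K x\<close> vanishes at nonsquares.\<close>
  have K_chi: "K x = \<chi> x * K x" if x: "x \<in> H" for x
  proof -
    have x0: "x \<noteq> 0" using H_nonzero[OF x] .
    have "K x = (\<Sum>y\<in>-{0}. \<chi> (b\<^sup>2 * x / y) * \<psi> (b\<^sup>2 * x / y + b\<^sup>2 * x / (b\<^sup>2 * x / y)))"
      unfolding K_def
      by (rule sum.reindex_bij_witness[of _ "\<lambda>y. b\<^sup>2 * x / y" "\<lambda>y. b\<^sup>2 * x / y"]) (use x0 b in auto)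
    also have "\<dots> = \<chi> x * K x"
      unfolding K_def sum_distrib_left
      by (rule sum.cong[OF refl])
        (use x0 b in \<open>simp add: chi_divide chi_mult quadratic_character_square add.commute\<close>)
    finally show ?thesis .
  qed
  \<comment> \<open>An \<open>x \<in> H\<close> has \<open>1 + \<chi> x\<close> square roots, all in
    \<open>H\<close>; by \<open>K_chi\<close> this weight acts on \<open>K x\<close> as the factor
    \<open>2\<close>. The sum over \<open>H\<close> thus becomes a sum over squares.\<close>
  have fib: "(\<Sum>d\<in>H. if d\<^sup>2 = x then K x else 0) = K x + K x" if x: "x \<in> H" for x
  proof -
    have "{d \<in> H. d\<^sup>2 = x} = {d. d\<^sup>2 = x}" using x square_in_H_iff by auto
    then have "(\<Sum>d\<in>H. if d\<^sup>2 = x then K x else 0) = of_nat (card {d. d\<^sup>2 = x}) * K x"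
      by (simp add: sum.If_cases Int_def)
    also have "\<dots> = K x + \<chi> x * K x"
      using H_nonzero[OF x] by (simp add: card_square_roots distrib_right)
    finally show ?thesis using K_chi[OF x] by simp
  qed
  have neg: "(\<Sum>d\<in>H. \<psi> (- (2 * b * d))) = h (2 * b)"
    unfolding h_def by (rule sum.reindex_bij_witness[of _ uminus uminus]) (auto intro: uminus_H)
  have "2 * (\<Sum>x\<in>H. K x) = (\<Sum>x\<in>H. \<Sum>d\<in>H. if d\<^sup>2 = x then K x else 0)"
    by (simp add: fib sum_distrib_left)
  also have "\<dots> = (\<Sum>d\<in>H. K (d\<^sup>2))"
    by (subst sum.swap) (simp add: square_in_H_iff)
  also have "\<dots> = (\<Sum>d\<in>H. Q * (\<psi> (2 * b * d) + \<psi> (- (2 * b * d))))"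
  proof (rule sum.cong[OF refl])
    fix d assume "d \<in> H"
    then have "b * d \<noteq> 0" using b H_nonzero by simp
    from salie_sum[OF this] show "K (d\<^sup>2) = Q * (\<psi> (2 * b * d) + \<psi> (- (2 * b * d)))"
      by (simp add: K_def power_mult_distrib mult.assoc)
  qed
  also have "\<dots> = Q * (h (2 * b) + h (2 * b))"
    by (simp add: sum.distrib neg flip: sum_distrib_left) (simp add: h_def)
  finally have "(\<Sum>x\<in>H. K x) = Q * h (2 * b)" by simp
  moreover have "(\<Sum>y\<in>-{0}. \<chi> y * \<psi> y * h (b\<^sup>2 / y)) = (\<Sum>x\<in>H. K x)"
    unfolding h_def K_def sum_distrib_left
    by (subst sum.swap) (simp add: psi_add mult.assoc)
  ultimately show ?thesis by simp
qed

lemma davenport_hasse: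
  assumes "c \<noteq> 0"
  shows "(\<Sum>y\<in>-{0}. \<chi> y * \<psi> y * h (c / y)) = Q * h c"
proof -
  obtain b a where ba: "b \<noteq> 0" "a \<in> H" "c = b\<^sup>2 * a" using eq_square_mult_H[OF assms] .
  have "h (c / y) = h (b\<^sup>2 / y)" for y
    using h_mult_H[OF ba(2), of "b\<^sup>2 / y"] by (simp add: ba)
  then have "(\<Sum>y\<in>-{0}. \<chi> y * \<psi> y * h (c / y)) = Q * h (2 * b)"
    using davenport_hasse_square[OF ba(1)] by simp
  also have "h (2 * b) = h c"
    using ba by (simp add: h_mult_H h_mult_H' two_in_H h_square)
  finally show ?thesis .
qed

text \<open>Orthogonality in \<open>c\<close> keeps the pairs with \<open>x = e * x'\<close>: there
  are \<open>card H\<close> of them if \<open>e \<in> H\<close> and none otherwise. The omitted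
  \<open>c = 0\<close> accounts for the subtracted square.\<close>

lemma h_correlation:
  assumes "e \<noteq> 0"
  shows "(\<Sum>c\<in>-{0}. h c * cnj (h (c * e)))
    = (if e \<in> H then of_nat CARD('a) * of_nat (card H) else 0) - of_nat (card H) ^ 2"
proof -
  have "(\<Sum>c\<in>-{0}. h c * cnj (h (c * e)))
      = (\<Sum>c\<in>-{0}. \<Sum>x\<in>H. \<Sum>x'\<in>H. \<psi> ((x - e * x') * c))"
    unfolding h_def cnj_sum sum_product cnj_psi
    by (intro sum.cong refl) (simp add: algebra_simps flip: psi_add)
  also have "\<dots> = (\<Sum>x\<in>H. \<Sum>x'\<in>H. \<Sum>c\<in>-{0}. \<psi> ((x - e * x') * c))"
    by (subst sum.swap, rule sum.cong[OF refl], rule sum.swap)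
  also have "\<dots> = (\<Sum>x\<in>H. \<Sum>x'\<in>H. (if x = e * x' then of_nat CARD('a) else 0) - 1)"
    unfolding sum_psi_nonzero by simp
  also have "\<dots> = (\<Sum>x'\<in>H. \<Sum>x\<in>H. if x = e * x' then of_nat CARD('a) else 0) - of_nat (card H) ^ 2"
    by (subst sum.swap) (simp add: sum_subtractf power2_eq_square)
  also have "(\<Sum>x'\<in>H. \<Sum>x\<in>H. if x = e * x' then of_nat CARD('a) else 0)
      = (if e \<in> H then of_nat CARD('a) * of_nat (card H) else (0::complex))"
    by (simp add: mult_H_iff' cong: sum.cong)
  finally show ?thesis .
qed

text \<open>
  Deconvolution: correlating both sides of \<open>davenport_hasse\<close> with \<open>h\<close> and inserting
  \<open>h_correlation\<close> isolates one coset of \<open>H\<close>.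
\<close>

lemma coset_gauss_sum:
  assumes e: "e \<noteq> 0"
  shows "(\<Sum>y\<in>-{0}. if y * e \<in> H then \<chi> y * \<psi> y else 0) = (if e \<in> H then Q else 0)"
proof -
  define v k :: complex where "v = of_nat CARD('a)" and "k = of_nat (card H)"
  define M where "M e = (\<Sum>c\<in>-{0}. h c * cnj (h (c * e)))" for e
  have M: "M e = (if e \<in> H then v * k else 0) - k\<^sup>2" if "e \<noteq> 0" for e
    using h_correlation[OF that] by (simp add: M_def v_def k_def)
  have "H \<noteq> {}" using one_H by auto
  then have vk: "v * k \<noteq> 0" by (simp add: v_def k_def)
  \<comment> \<open>Replacing \<open>Q * h c\<close> by the convolution and summing over
    \<open>c\<close> first produces \<open>M (y * e)\<close>. By \<open>M\<close>, both sides are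
    then indicators of \<open>H\<close> up to the same constant \<open>- k\<^sup>2 * Q\<close>,
    which cancels.\<close>
  have "Q * M e = (\<Sum>c\<in>-{0}. (\<Sum>y\<in>-{0}. \<chi> y * \<psi> y * h (c / y)) * cnj (h (c * e)))"
    unfolding M_def sum_distrib_left by (rule sum.cong) (auto simp: davenport_hasse)
  also have "\<dots> = (\<Sum>y\<in>-{0}. \<chi> y * \<psi> y * (\<Sum>c\<in>-{0}. h (c / y) * cnj (h (c * e))))"
    unfolding sum_distrib_left sum_distrib_right
    by (subst sum.swap) (simp add: mult.assoc)
  also have "\<dots> = (\<Sum>y\<in>-{0}. \<chi> y * \<psi> y * M (y * e))"
  proof (intro sum.cong refl arg_cong2[where f = "(*)"])
    fix y :: 'a assume "y \<in> - {0}"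
    then have y: "y \<noteq> 0" by simp
    show "(\<Sum>c\<in>-{0}. h (c / y) * cnj (h (c * e))) = M (y * e)"
      unfolding M_def
      by (rule sum.reindex_bij_witness[of _ "\<lambda>c. c * y" "\<lambda>c. c / y"]) (use y in \<open>auto simp: mult_ac\<close>)
  qed
  also have "\<dots> = (\<Sum>y\<in>-{0}. v * k * (if y * e \<in> H then \<chi> y * \<psi> y else 0) - k\<^sup>2 * (\<chi> y * \<psi> y))"
    by (rule sum.cong) (use e in \<open>auto simp: M algebra_simps\<close>)
  also have "\<dots> = v * k * (\<Sum>y\<in>-{0}. if y * e \<in> H then \<chi> y * \<psi> y else 0) - k\<^sup>2 * Q"
    by (simp add: sum_subtractf Q_nonzero_sum flip: sum_distrib_left)
  finally have "v * k * (\<Sum>y\<in>-{0}. if y * e \<in> H then \<chi> y * \<psi> y else 0) = Q * (M e + k\<^sup>2)"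
    by (simp add: algebra_simps)
  then have "v * k * (\<Sum>y\<in>-{0}. if y * e \<in> H then \<chi> y * \<psi> y else 0)
      = v * k * (if e \<in> H then Q else 0)"
    unfolding M[OF e] diff_add_cancel by (simp only: mult_ac if_distrib mult_zero_right mult_zero_left)
  then show ?thesis using vk by simp
qed

text \<open>\<open>F\<close> is constant on cosets of \<open>H\<close>, and by
  \<open>coset_gauss_sum\<close> only the coset \<open>H\<close> itself contributes.\<close>

lemma gauss_sum_H_invariant:
  assumes inv: "\<And>x a. a \<in> H \<Longrightarrow> F (x * a) = F x"
  shows "(\<Sum>x\<in>UNIV. F x * \<chi> x * \<psi> x) = F 1 * Q"
proof -
  have "H \<noteq> {}" using one_H by auto
  then have cH: "of_nat (card H) \<noteq> (0::complex)" by simp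
  \<comment> \<open>Instead of choosing coset representatives, \<open>e\<close> runs through all
    nonzero elements; each \<open>x\<close> then satisfies \<open>x * e \<in> H\<close> for exactly
    \<open>card H\<close> of them.\<close>
  have "of_nat (card H) * (\<Sum>x\<in>UNIV. F x * \<chi> x * \<psi> x)
      = (\<Sum>x\<in>-{0}. of_nat (card H) * (F x * \<chi> x * \<psi> x))"
    unfolding sum_distrib_left by (rule sum.mono_neutral_right) auto
  also have "\<dots> = (\<Sum>x\<in>-{0}. \<Sum>e\<in>-{0}. if x * e \<in> H then F (1 / e) * (\<chi> x * \<psi> x) else 0)"
  proof (rule sum.cong[OF refl])
    fix x :: 'a assume "x \<in> - {0}"
    then have x: "x \<noteq> 0" by simp
    have cancel: "x * inverse (x * a) = inverse a" for a
      using x by (cases "a = 0") (simp_all add: field_simps)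
    have "(\<Sum>e\<in>-{0}. if x * e \<in> H then F (1 / e) * (\<chi> x * \<psi> x) else 0)
        = (\<Sum>a\<in>-{0}. if a \<in> H then F (x * inverse a) * (\<chi> x * \<psi> x) else 0)"
      by (rule sum.reindex_bij_witness[of _ "\<lambda>a. a / x" "\<lambda>e. x * e"])
        (use x in \<open>auto simp: cancel inverse_eq_divide[symmetric] simp del: inverse_mult_distrib\<close>)
    also have "\<dots> = (\<Sum>a\<in>H. F x * (\<chi> x * \<psi> x))"
      by (rule sum.mono_neutral_cong_right) (use H_nonzero inverse_H inv in auto)
    finally show "of_nat (card H) * (F x * \<chi> x * \<psi> x)
        = (\<Sum>e\<in>-{0}. if x * e \<in> H then F (1 / e) * (\<chi> x * \<psi> x) else 0)"
      by (simp add: mult_ac)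
  qed
  also have "\<dots> = (\<Sum>e\<in>-{0}. F (1 / e) * (\<Sum>x\<in>-{0}. if x * e \<in> H then \<chi> x * \<psi> x else 0))"
    unfolding sum_distrib_left by (subst sum.swap) (intro sum.cong refl, simp)
  also have "\<dots> = (\<Sum>e\<in>-{0}. if e \<in> H then F 1 * Q else 0)"
  proof (rule sum.cong[OF refl])
    fix e :: 'a assume "e \<in> - {0}"
    then show "F (1 / e) * (\<Sum>x\<in>-{0}. if x * e \<in> H then \<chi> x * \<psi> x else 0)
        = (if e \<in> H then F 1 * Q else 0)"
      using inv[of "inverse e" 1] inverse_H[of e] by (simp add: coset_gauss_sum divide_inverse)
  qed
  also have "\<dots> = (\<Sum>e\<in>H. F 1 * Q)"
    by (rule sum.mono_neutral_cong_right) (use H_nonzero in auto)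
  finally show ?thesis using cH by simp
qed

text \<open>For \<open>a \<noteq> 0\<close> the Fourier coefficient \<open>W a\<close> equals
  \<open>\<chi> a * F (1 / a) * Q\<close>, of squared modulus \<open>CARD('a)\<close>, and
  \<open>W 0 = 0\<close>. Fourier inversion of these squared moduli gives the
  autocorrelation.\<close>

lemma autocorrelation:
  assumes inv: "\<And>x a. a \<in> H \<Longrightarrow> F (x * a) = F x"
    and unimodular: "\<And>x. x \<noteq> 0 \<Longrightarrow> F x * cnj (F x) = 1"
    and S: "\<And>x. S x = F x * \<chi> x"
  shows "(\<Sum>x\<in>UNIV. S x) = 0"
    and "g \<noteq> 0 \<Longrightarrow> (\<Sum>x\<in>UNIV. S x * cnj (S (x - g))) = - 1"
proof -
  obtain u where u: "\<chi> u = - 1" using exists_chi_minus_one by blast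
  then have u0: "u \<noteq> 0" by auto
  \<comment> \<open>\<open>u ^ n\<close> lies in \<open>H\<close>, so it fixes \<open>F\<close>, but
    it negates \<open>\<chi>\<close> because \<open>n\<close> is odd.\<close>
  have "(\<Sum>x\<in>UNIV. S x) = (\<Sum>x\<in>UNIV. S (x * u ^ n))"
    by (rule sum.reindex_bij_witness[of _ "\<lambda>x. x * u ^ n" "\<lambda>x. x / u ^ n"]) (use u0 in auto)
  also have "\<dots> = - (\<Sum>x\<in>UNIV. S x)"
    using odd_n by (simp add: S inv powerH[OF u0] chi_mult chi_power u sum_negf)
  finally show sum_S: "(\<Sum>x\<in>UNIV. S x) = 0" by simp
  define W where "W a = (\<Sum>x\<in>UNIV. S x * \<psi> (a * x))" for a
  have W0: "W 0 = 0" by (simp add: W_def sum_S)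
  have W: "W a * cnj (W a) = of_nat CARD('a)" if a: "a \<noteq> 0" for a
  proof -
    define F' where "F' x = F (x / a)" for x
    have "W a = (\<Sum>x\<in>UNIV. S (x / a) * \<psi> x)"
      unfolding W_def
      by (rule sum.reindex_bij_witness[of _ "\<lambda>x. x / a" "\<lambda>x. a * x"]) (use a in auto)
    also have "\<dots> = \<chi> a * (\<Sum>x\<in>UNIV. F' x * \<chi> x * \<psi> x)"
      by (simp add: S F'_def chi_divide sum_distrib_left mult_ac)
    also have "(\<Sum>x\<in>UNIV. F' x * \<chi> x * \<psi> x) = F' 1 * Q"
      using inv[of _ "_ / a"] by (intro gauss_sum_H_invariant) (simp add: F'_def flip: times_divide_eq_left)
    finally have "W a * cnj (W a) = (\<chi> a * \<chi> a) * (F' 1 * cnj (F' 1)) * (Q * cnj Q)"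
      by (simp add: mult_ac)
    then show ?thesis
      using a unimodular[of "1 / a"] by (simp add: chi_mult_self F'_def Q_mult_cnj)
  qed
  assume g: "g \<noteq> 0"
  \<comment> \<open>The condition \<open>y = x - g\<close> is turned into a character sum by
    \<open>sum_psi\<close>.\<close>
  have "of_nat CARD('a) * (\<Sum>x\<in>UNIV. S x * cnj (S (x - g)))
      = (\<Sum>x\<in>UNIV. \<Sum>y\<in>UNIV. S x * cnj (S y) * (if x - y - g = 0 then of_nat CARD('a) else 0))"
  proof -
    have "(\<Sum>y\<in>UNIV. S x * cnj (S y) * (if x - y - g = 0 then of_nat CARD('a) else 0))
        = (\<Sum>y\<in>UNIV. if y = x - g then S x * cnj (S y) * of_nat CARD('a) else 0)" for x
      by (rule sum.cong) (auto simp: algebra_simps)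
    then show ?thesis by (simp add: sum_distrib_left mult_ac)
  qed
  also have "\<dots> = (\<Sum>x\<in>UNIV. \<Sum>y\<in>UNIV. \<Sum>a\<in>UNIV. S x * cnj (S y) * \<psi> ((x - y - g) * a))"
    unfolding sum_psi[symmetric] sum_distrib_left ..
  also have "\<dots> = (\<Sum>a\<in>UNIV. \<Sum>x\<in>UNIV. \<Sum>y\<in>UNIV. S x * cnj (S y) * \<psi> ((x - y - g) * a))"
    by (subst sum.swap[of _ "UNIV :: 'a set" "UNIV :: 'a set"], subst (2) sum.swap) (rule refl)
  also have "\<dots> = (\<Sum>a\<in>UNIV. W a * cnj (W a) * \<psi> (- g * a))"
  proof -
    have "\<psi> (a * x) * \<psi> (- (a * y)) * \<psi> (- g * a) = \<psi> ((x - y - g) * a)" for a x y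
      by (simp add: algebra_simps flip: psi_add)
    then have "S x * cnj (S y) * \<psi> ((x - y - g) * a)
        = S x * \<psi> (a * x) * (cnj (S y) * \<psi> (- (a * y))) * \<psi> (- g * a)" for a x y
      by (metis (no_types) mult.assoc mult.left_commute)
    then show ?thesis
      by (simp only: W_def cnj_sum complex_cnj_mult cnj_psi sum_product)
        (simp only: sum_distrib_right)
  qed
  also have "\<dots> = (\<Sum>a\<in>-{0}. of_nat CARD('a) * \<psi> (- g * a))"
    by (rule sum.mono_neutral_cong_right) (use W0 W in auto)
  also have "\<dots> = of_nat CARD('a) * (- 1)"
    using g unfolding sum_distrib_left[symmetric] sum_psi_nonzero by simp
  finally show "(\<Sum>x\<in>UNIV. S x * cnj (S (x - g))) = - 1"
    by (subst (asm) mult_cancel_left) simp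
qed

end

section \<open>Subgroups of index two in the unit group\<close>

text \<open>In \<open>y ^ p - 1 = (y - 1) * (\<Sum>i<p. y ^ i)\<close> the second factor is
  congruent to \<open>p\<close>, hence to \<open>0\<close>, modulo \<open>p\<close>, so each step
  gains one factor \<open>p\<close>.\<close>

lemma cong_1_prime_power_lift:
  fixes x :: int and p :: nat
  assumes "[x = 1] (mod int p)"
  shows "[x ^ (p ^ k) = 1] (mod int p ^ Suc k)"
proof (induction k)
  case 0
  then show ?case using assms by simp
next
  case (Suc k)
  define y where "y = x ^ (p ^ k)"
  have "[y = 1] (mod int p)"
    unfolding y_def using cong_pow[OF assms, of "p ^ k"] by simp
  then have "[(\<Sum>i<p. y ^ i) = (\<Sum>i<p. 1 ^ i)] (mod int p)"
    by (intro cong_sum cong_pow)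
  then have "int p dvd (\<Sum>i<p. y ^ i)"
    by (simp add: cong_0_iff[symmetric] cong_def)
  moreover have "int p ^ Suc k dvd y - 1"
    using Suc by (simp add: y_def cong_iff_dvd_diff)
  ultimately have "int p ^ Suc k * int p dvd (y - 1) * (\<Sum>i<p. y ^ i)"
    by (rule mult_dvd_mono[rotated])
  also have "(y - 1) * (\<Sum>i<p. y ^ i) = y ^ p - 1"
    by (rule power_diff_1_eq[symmetric])
  also have "y ^ p = x ^ (p ^ Suc k)"
    by (simp add: y_def mult.commute flip: power_mult)
  finally show ?case by (simp add: cong_iff_dvd_diff mult.commute)
qed

text \<open>Gauss's lemma for \<open>2\<close>: with \<open>p = 8 * k + 7\<close>, the doubles
  exceeding \<open>(p - 1) div 2 = 4 * k + 3\<close> come from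
  \<open>2 * k + 2 \<le> i \<le> 4 * k + 3\<close>, an even number of values.\<close>

lemma two_power_half_cong_1:
  fixes p :: nat
  assumes "prime p" and "[p = 7] (mod 8)"
  shows "[2 ^ ((p - 1) div 2) = (1::int)] (mod int p)"
proof -
  define k where "k = p div 8"
  have p: "p = 8 * k + 7" using assms(2) by (simp add: k_def cong_def) presburger
  interpret GAUSS p 2
  proof
    show "[2 \<noteq> 0] (mod int p)"
      using p by (auto simp: cong_0_iff dest: zdvd_imp_le)
  qed (use assms p in auto)
  have half: "(int p - 1) div 2 = 4 * int k + 3" using p by simp
  have "E = (\<lambda>i. 2 * i) ` {2 * int k + 2..4 * int k + 3}"
  proof -
    \<comment> \<open>No reduction takes place, since
      \<open>2 * x \<le> 8 * k + 6 < p\<close>.\<close>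
    have "x * 2 mod int p = 2 * x" if "x \<in> A" for x
    proof -
      have "0 < x" "x \<le> 4 * int k + 3" using that by (auto simp: A_def half)
      then show ?thesis using p by simp
    qed
    then have "C = (\<lambda>i. 2 * i) ` A"
      unfolding C_def B_def image_image by (rule image_cong[OF refl])
    then show ?thesis
      unfolding E_def half A_def by auto
  qed
  then have "card E = 2 * k + 2"
    by (simp add: card_image inj_on_def)
  moreover have "nat ((int p - 1) div 2) = (p - 1) div 2" using p by simp
  ultimately show ?thesis using pre_gauss_lemma by simp
qed

text \<open>If \<open>a \<notin> H\<close>, the only cosets are \<open>H\<close> and
  \<open>H #> a\<close>, and \<open>a \<otimes> a \<in> H #> a\<close> would give
  \<open>a \<in> H\<close> by cancellation.\<close>

lemma (in group) square_mem_index_2_subgroup: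
  assumes H: "subgroup H G" and idx: "card (rcosets H) = 2" and a: "a \<in> carrier G"
  shows "a \<otimes> a \<in> H"
proof (cases "a \<in> H")
  case True
  then show ?thesis using H by (simp add: subgroup.m_closed)
next
  case False
  have HC: "H \<subseteq> carrier G" using H by (rule subgroup.subset)
  have "H #> \<one> = H" using HC by (rule coset_mult_one)
  then have mem: "H \<in> rcosets H" "H #> a \<in> rcosets H" "H #> (a \<otimes> a) \<in> rcosets H"
    using rcosetsI[OF HC] a by (metis one_closed, auto)
  have neq: "H #> a \<noteq> H" using False coset_join1[OF _ a H] by blast
  obtain X Y where "rcosets H = {X, Y}" using idx by (auto simp: card_2_iff)
  then have "H #> (a \<otimes> a) = H \<or> H #> (a \<otimes> a) = H #> a" using mem neq by auto
  moreover have "H #> (a \<otimes> a) \<noteq> H #> a"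
  proof
    assume "H #> (a \<otimes> a) = H #> a"
    then have "a \<otimes> a \<in> H #> a" using rcos_self[of "a \<otimes> a" H] a H by auto
    then obtain b where "b \<in> H" "a \<otimes> a = b \<otimes> a" by (auto simp: r_coset_def)
    then have "a \<in> H" using a HC by (metis right_cancel subsetD)
    then show False using False by simp
  qed
  ultimately show ?thesis using coset_join1[OF _ _ H, of "a \<otimes> a"] a by auto
qed

lemma (in residues) units_of_nat_pow:
  assumes "a \<in> Units R"
  shows "a [^]\<^bsub>units_of R\<^esub> (k::nat) = a ^ k mod m"
proof (induction k)
  case 0
  then show ?case using m_gt_one by (simp add: units_of_one res_one_eq)
next
  case (Suc k)
  then show ?case
    by (simp add: units_of_mult res_mult_eq mod_simps mult.commute)
qed

text \<open>The subgroup has order \<open>u = (p1 - 1) div 2 * p1 ^ (m - 1)\<close>, which is odd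
  since \<open>p1\<close> is \<open>3\<close> modulo \<open>4\<close>. An element with
  \<open>u\<close>-th power \<open>1\<close> is therefore a square, and squares lie in a subgroup of
  index two.\<close>

lemma index_2_consequences:
  fixes p1 m N p :: nat
  assumes p1: "prime p1" "[p1 = 7] (mod 8)" and m: "m > 0" and N: "N = 2 * p1 ^ m"
    and cop: "coprime p N"
    and idx: "card (rcosets\<^bsub>zmod_units N\<^esub> (gen_mod N p)) = 2"
  shows "odd (ord N p)" and "\<exists>j. [p ^ j = 2] (mod p1 ^ m)"
proof -
  define n where "n = p1 ^ m"
  have p1_ge: "p1 \<ge> 7" using p1(2) by (cases "p1 < 7") (auto simp: cong_def)
  have odd_p1: "odd p1" using p1(1) p1_ge prime_odd_nat by force
  have odd_n: "odd n" using odd_p1 by (simp add: n_def)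
  have n1: "n > 1" unfolding n_def using p1_ge m by (intro one_less_power) auto
  have N': "N = 2 * n" by (simp add: N n_def)
  let ?R = "residue_ring (int N)"
  interpret R: residues "int N" ?R
    by unfold_locales (use n1 N' in auto)
  let ?G = "zmod_units N"
  interpret G: group ?G by (rule R.units_group)
  define P where "P = int p mod int N"
  have PU: "P \<in> Units ?R" unfolding P_def
    using cop R.m_gt_one by (intro R.mod_in_res_units) auto
  then have P: "P \<in> carrier ?G" by (simp add: units_of_carrier)
  have finG: "finite (carrier ?G)" by (simp add: units_of_carrier R.finite_Units)
  let ?H = "generate ?G {P}"
  have H: "gen_mod N p = ?H" by (simp add: gen_mod_def P_def)
  have subH: "subgroup ?H ?G" using P by (intro G.generate_is_subgroup) simp
  define u where "u = card ?H"
  have "2 * u = totient N"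
    using G.lagrange_finite[OF finG subH] idx R.totient_eq
    by (simp add: H u_def Coset.order_def units_of_carrier)
  also have "\<dots> = totient n" unfolding N' using odd_n
    by (subst totient_mult_coprime) (auto simp: totient_prime)
  also have "\<dots> = p1 ^ (m - 1) * (p1 - 1)"
    unfolding n_def using p1(1) m by (rule totient_prime_power)
  finally have "2 * u = 2 * (p1 ^ (m - 1) * ((p1 - 1) div 2))"
    using odd_p1 by simp
  then have u: "u = (p1 - 1) div 2 * p1 ^ (m - 1)" by simp
  have "odd ((p1 - 1) div 2)"
    using p1(2) unfolding cong_def by presburger
  then have odd_u: "odd u" using odd_p1 by (simp add: u)
  have "P [^]\<^bsub>?G\<^esub> u = \<one>\<^bsub>?G\<^esub>"
    unfolding u_def using G.generate_pow_card[OF P] G.pow_ord_eq_1[OF P] by simp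
  then have "[P ^ u = 1] (mod int N)"
    using R.units_of_nat_pow[OF PU, of u] R.m_gt_one
    by (simp add: units_of_one R.res_one_eq cong_def)
  then have "[int p ^ u = 1] (mod int N)" by (simp add: P_def cong_def mod_simps)
  then have "[p ^ u = 1] (mod N)" by (simp flip: cong_int_iff)
  then have "ord N p dvd u" by (simp only: ord_divides)
  then show "odd (ord N p)" using odd_u by auto
  have two_u: "[2 ^ u = 1] (mod int n)"
    using cong_1_prime_power_lift[OF two_power_half_cong_1[OF p1], of "m - 1"] m
    by (simp add: u n_def power_mult)
  \<comment> \<open>\<open>2\<close> is no unit modulo the even number \<open>N\<close>;
    \<open>t\<close> is an odd number with the same residue modulo \<open>n\<close>.\<close>
  define t where "t = 2 + int n"
  have odd_t: "odd t" using odd_n by (simp add: t_def)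
  have "[t = 2] (mod int n)" by (simp add: t_def cong_def)
  then have "[t ^ u = 1] (mod int n)" using two_u cong_pow cong_trans by blast
  moreover have "[t ^ u = 1] (mod 2)" using odd_t by (simp add: cong_def odd_iff_mod_2_eq_one[symmetric])
  ultimately have t_u: "[t ^ u = 1] (mod int N)"
    unfolding N' using odd_n by (simp add: cong_iff_dvd_diff divides_mult)
  \<comment> \<open>As \<open>u\<close> is odd and \<open>t ^ u\<close> is \<open>1\<close> modulo
    \<open>N\<close>, this is a square root of \<open>t ^ Suc u\<close>, that is, of
    \<open>t\<close>.\<close>
  define w where "w = t ^ (Suc u div 2) mod int N"
  have w2: "[w * w = t] (mod int N)"
  proof -
    have "Suc u div 2 + Suc u div 2 = Suc u" using odd_u by presburger
    then have "[w * w = t ^ Suc u] (mod int N)"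
      by (simp add: w_def cong_def mod_simps flip: power_add)
    also have "[t ^ Suc u = t * 1] (mod int N)"
      using cong_mult[OF cong_refl t_u] by simp
    finally show ?thesis by simp
  qed
  have "coprime (t ^ u) (int N)" using cong_imp_coprime[OF cong_sym[OF t_u]] by simp
  then have "coprime t (int N)" using odd_u by (cases u) auto
  then have "w \<in> Units ?R" unfolding w_def
    using R.m_gt_one by (intro R.mod_in_res_units) auto
  then have "w \<otimes>\<^bsub>?G\<^esub> w \<in> ?H"
    using G.square_mem_index_2_subgroup[OF subH] idx by (simp add: H units_of_carrier)
  then obtain j :: nat where "w \<otimes>\<^bsub>?G\<^esub> w = P [^]\<^bsub>?G\<^esub> j"
    using G.generate_pow_on_finite_carrier[OF finG P] by auto
  then have "[w * w = P ^ j] (mod int N)"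
    using R.units_of_nat_pow[OF PU] by (simp add: units_of_mult R.res_mult_eq cong_def)
  also have "[P ^ j = int p ^ j] (mod int N)" by (simp add: P_def cong_def mod_simps)
  finally have "[int p ^ j = t] (mod int N)" using w2 cong_sym cong_trans by blast
  then have "[int p ^ j = t] (mod int n)" by (rule cong_dvd_modulus) (simp add: N')
  also have "[t = 2] (mod int n)" by fact
  finally have "[p ^ j = 2] (mod n)" by (simp flip: cong_int_iff)
  then show "\<exists>j. [p ^ j = 2] (mod p1 ^ m)" by (auto simp: n_def)
qed

section \<open>Difference counts\<close>

definition sign_of :: "'a::zero set \<Rightarrow> 'a \<Rightarrow> complex" where
  "sign_of D x = (if x = 0 then 0 else if x \<in> D then 1 else - 1)"

lemma card_eq_of_sum_sign:
  fixes D :: "'a::{ab_group_add,finite} set"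
  assumes "0 \<notin> D" and "(\<Sum>x\<in>UNIV. sign_of D x) = 0"
  shows "2 * of_nat (card D) = (of_nat CARD('a) - 1 :: complex)"
proof -
  have "2 * (if x \<in> D then 1 else 0) = sign_of D x + 1 - (if x = 0 then 1 else 0)" for x
    using assms(1) by (auto simp: sign_of_def)
  then have "(\<Sum>x\<in>UNIV. 2 * (if x \<in> D then 1 else 0 :: complex))
      = (\<Sum>x\<in>UNIV. sign_of D x + 1 - (if x = 0 then 1 else 0))" by simp
  then show ?thesis using assms(2)
    by (simp add: sum.distrib sum_subtractf sum.If_cases flip: sum_distrib_left)
qed

text \<open>Twice the indicator of \<open>D\<close> is \<open>sign_of D + 1\<close> away from
  \<open>0\<close>. Multiplying two translates, the linear terms sum to \<open>0\<close>, and the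
  corrections at \<open>x = 0\<close> and \<open>x = g\<close> produce the signs of
  \<open>- g\<close> and \<open>g\<close>.\<close>

lemma difference_count_eq_of_autocorrelation:
  fixes D :: "'a::{ab_group_add,finite} set"
  assumes D0: "0 \<notin> D" and sum0: "(\<Sum>x\<in>UNIV. sign_of D x) = 0" and g: "g \<noteq> 0"
    and corr: "(\<Sum>x\<in>UNIV. sign_of D x * cnj (sign_of D (x - g))) = - 1"
  shows "4 * of_nat (difference_count D g)
    = of_nat CARD('a) - 3 - sign_of D g - sign_of D (- g)"
proof -
  define S where "S = sign_of D"
  define u :: "'a \<Rightarrow> complex" where "u x = (if x \<in> D then 1 else 0)" for x
  have cnjS: "cnj (S x) = S x" for x by (simp add: S_def sign_of_def)
  have S0: "S 0 = 0" by (simp add: S_def sign_of_def)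
  have u: "2 * u x = S x + 1 - (if x = 0 then 1 else 0)" for x
    using D0 by (auto simp: S_def sign_of_def u_def)
  have shift: "(\<Sum>x\<in>UNIV. S (x - g)) = 0"
  proof -
    have "(\<Sum>x\<in>UNIV. S (x - g)) = (\<Sum>x\<in>UNIV. S x)"
      by (rule sum.reindex_bij_witness[of _ "\<lambda>x. x + g" "\<lambda>x. x - g"]) auto
    then show ?thesis using sum0 by (simp add: S_def)
  qed
  have "difference_count D g = card {x. x \<in> D \<and> x - g \<in> D}"
    unfolding difference_count_def
    by (rule bij_betw_same_card[of fst], rule bij_betw_byWitness[of _ "\<lambda>x. (x, x - g)"])
      (auto simp: algebra_simps)
  then have "of_nat (difference_count D g)
      = (\<Sum>x\<in>UNIV. if x \<in> D \<and> x - g \<in> D then 1 else 0 :: complex)"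
    by (simp add: sum.If_cases)
  also have "\<dots> = (\<Sum>x\<in>UNIV. u x * u (x - g))"
    by (rule sum.cong) (auto simp: u_def)
  finally have "4 * of_nat (difference_count D g) = 4 * (\<Sum>x\<in>UNIV. u x * u (x - g))"
    by simp
  also have "\<dots> = (\<Sum>x\<in>UNIV. (2 * u x) * (2 * u (x - g)))"
    by (simp add: sum_distrib_left mult_ac)
  also have "\<dots> = (\<Sum>x\<in>UNIV. S x * cnj (S (x - g)) + S x + S (x - g) + 1
      - (if x = 0 then S (- g) + 1 else 0) - (if x = g then S g + 1 else 0))"
    unfolding u cnjS by (rule sum.cong[OF refl]) (use g S0 in \<open>auto simp: algebra_simps\<close>)
  also have "\<dots> = - 1 + of_nat CARD('a) - (S (- g) + 1) - (S g + 1)"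
    using corr sum0 shift by (simp add: sum.distrib sum_subtractf S_def)
  finally show ?thesis by (simp add: S_def)
qed

section \<open>Cyclotomic classes, transversals and the character at \<open>- 1\<close>\<close>

lemma power_mem_cyclotomic_class_iff:
  fixes \<gamma> :: "'a::finite_field"
  assumes prim: "primitive_element \<gamma>" and N: "N dvd CARD('a) - 1"
  shows "\<gamma> ^ t \<in> cyclotomic_class N \<gamma> i \<longleftrightarrow> [t = i] (mod N)"
proof
  have g0: "\<gamma> \<noteq> 0" using prim by (simp add: primitive_element_def)
  {
    assume "\<gamma> ^ t \<in> cyclotomic_class N \<gamma> i"
    then obtain j :: int where j: "\<gamma> ^ t = \<gamma> ^ i * (\<gamma> ^ N) powi j"
      by (auto simp: cyclotomic_class_def)
    \<comment> \<open>The positive and negative parts of \<open>j\<close> go to opposite sides,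
      which keeps all exponents natural.\<close>
    have "\<gamma> ^ (t + N * nat (- j)) = \<gamma> ^ (i + N * nat j)"
      using g0 by (simp add: power_add j power_int_def power_mult field_simps)
    then have "[t + N * nat (- j) = i + N * nat j] (mod (CARD('a) - 1))"
      using primitive_element_power_eq_iff[OF prim] by blast
    then have "[t + N * nat (- j) = i + N * nat j] (mod N)"
      using N by (rule cong_dvd_modulus_nat)
    then show "[t = i] (mod N)" by (simp add: cong_def)
  next
    assume "[t = i] (mod N)"
    then obtain a b where ab: "i + a * N = t + b * N"
      unfolding cong_iff_lin_nat by blast
    have "\<gamma> ^ t * (\<gamma> ^ N) ^ b = \<gamma> ^ i * (\<gamma> ^ N) ^ a"
      using arg_cong[OF ab, of "\<lambda>k. \<gamma> ^ k"] by (simp add: power_add mult.commute flip: power_mult)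
    then have "\<gamma> ^ t = \<gamma> ^ i * ((\<gamma> ^ N) ^ a / (\<gamma> ^ N) ^ b)"
      using g0 by (simp add: field_simps)
    also have "(\<gamma> ^ N) ^ a / (\<gamma> ^ N) ^ b = (\<gamma> ^ N) powi (int a - int b)"
      using g0 by (simp add: power_int_diff)
    finally show "\<gamma> ^ t \<in> cyclotomic_class N \<gamma> i"
      by (auto simp: cyclotomic_class_def)
  }
qed

text \<open>The two residues in question are those modulo \<open>2 * n\<close> lying over
  \<open>t mod n\<close>, and \<open>I\<close> contains exactly one of them. Hence multiplication by
  \<open>\<gamma> ^ n\<close> exchanges membership and non-membership in \<open>D\<close> for
  nonzero elements.\<close>

lemma transversal_shift:
  fixes n t :: nat
  assumes I: "I \<subseteq> {..<2 * n}" and img: "(\<lambda>i. i mod n) ` I = {..<n}" and inj: "inj_on (\<lambda>i. i mod n) I"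
    and n: "n > 0"
  shows "(t + n) mod (2 * n) \<in> I \<longleftrightarrow> t mod (2 * n) \<notin> I"
proof -
  define a b where "a = t mod (2 * n)" and "b = (t + n) mod (2 * n)"
  have ab: "a mod n = t mod n" "b mod n = t mod n" by (simp_all add: a_def b_def mod_mod_cancel)
  have a2: "a < 2 * n" using n by (simp add: a_def)
  have "b = (a + n) mod (2 * n)" by (simp add: a_def b_def mod_simps)
  then have b: "b = (if a < n then a + n else a - n)"
    using a2 by (cases "a < n") (simp_all add: le_mod_geq)
  have md: "i mod n = (if i < n then i else i - n)" if "i < 2 * n" for i
    using that by (cases "i < n") (simp_all add: le_mod_geq)
  have "t mod n \<in> (\<lambda>i. i mod n) ` I" using img n by simp
  then obtain i where i: "i \<in> I" "i mod n = a mod n" using ab by auto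
  then have "i < 2 * n" using I by auto
  then have "i = a \<or> i = b" using i(2) a2 b by (auto simp: md split: if_splits)
  moreover have "\<not> (a \<in> I \<and> b \<in> I)"
    using inj_onD[OF inj, of a b] ab n b by (auto split: if_splits)
  ultimately show ?thesis using i(1) by (auto simp: a_def b_def)
qed

text \<open>The power of \<open>\<gamma>\<close> with exponent \<open>(CARD('a) - 1) div 2\<close>
  is a square root of \<open>1\<close> other than \<open>1\<close>, hence
  \<open>- 1\<close>.\<close>

lemma quadratic_character_minus_one:
  fixes \<gamma> :: "'a::finite_field"
  assumes prim: "primitive_element \<gamma>" and odd: "odd CARD('a)"
  shows "quadratic_character (- 1 :: 'a) = (- 1) ^ ((CARD('a) - 1) div 2)"
proof -
  let ?h = "(CARD('a) - 1) div 2"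
  have "card {0::'a, 1} \<le> CARD('a)" by (intro card_mono) auto
  then have "CARD('a) > 1" by simp
  then have h: "2 * ?h = CARD('a) - 1" "0 < ?h" "?h < CARD('a) - 1" using odd by (auto elim!: oddE)
  have "(\<gamma> ^ ?h)\<^sup>2 = 1"
    using primitive_element_power_eq_iff[OF prim, of "2 * ?h" 0] h
    by (simp add: cong_def mult.commute flip: power_mult)
  moreover have "\<gamma> ^ ?h \<noteq> 1"
    using primitive_element_power_eq_iff[OF prim, of ?h 0] h by (auto simp: cong_def)
  ultimately have "\<gamma> ^ ?h = - 1" by (simp add: power2_eq_1_iff)
  then show ?thesis using quadratic_character_power_primitive[OF prim odd, of ?h] by simp
qed

theorem theorem3p2:
  fixes p1 m N p f q s :: nat
    and \<gamma> :: "'a::finite_field"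
    and I :: "nat set"
    and D :: "'a set"
  assumes "prime p1" and "[p1 = 7] (mod 8)"
    and "m > 0"
    and "N = 2 * p1 ^ m"
    and "prime p" and "coprime p N"
    and "(- 1) mod int N \<notin> gen_mod N p"
    and "card (rcosets\<^bsub>zmod_units N\<^esub> (gen_mod N p)) = 2"
    and "f = ord N p" and "q = p ^ f"
    and "s > 0" and "odd s"
    and "CARD('a) = q ^ s"
    and "primitive_element \<gamma>"
    and "I \<subseteq> {..<N}"
    and "(\<lambda>i. i mod p1 ^ m) ` I = {..<p1 ^ m}"
    and "card I = p1 ^ m"
    and "D = (\<Union>i\<in>I. cyclotomic_class N \<gamma> i)"
  shows "([p = 3] (mod 4) \<longrightarrow> skew_hadamard_difference_set D) \<and>
         ([p = 1] (mod 4) \<longrightarrow> paley_type_pds D)"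
proof -
  define n where "n = p1 ^ m"
  have N: "N = 2 * n" using assms(4) by (simp add: n_def)
  note prim = assms(14)
  have g0: "\<gamma> \<noteq> 0" using prim by (simp add: primitive_element_def)
  have "p1 \<ge> 7" using assms(2) by (cases "p1 < 7") (auto simp: cong_def)
  then have odd_p1: "odd p1" using assms(1) prime_odd_nat by force
  have "p1 ^ 1 \<le> n" unfolding n_def using \<open>p1 \<ge> 7\<close> assms(3) by (intro power_increasing) auto
  then have n2: "n > 2" using \<open>p1 \<ge> 7\<close> by simp
  have odd_n: "odd n" using odd_p1 by (simp add: n_def)
  have odd_p: "odd p" using assms(6) by (auto simp: N)
  have card: "CARD('a) = p ^ (f * s)" using assms by (simp add: power_mult)
  have odd_card: "odd CARD('a)" using odd_p by (simp add: card)
  have char: "CHAR('a) = p"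
  proof -
    have "CHAR('a) dvd p ^ (f * s)" using CHAR_dvd_CARD[where ?'a = 'a] by (simp add: card)
    then have "CHAR('a) dvd p" by (rule prime_dvd_power[rotated]) simp
    then show ?thesis using assms(5) by (simp add: primes_dvd_imp_eq)
  qed
  have odd_fs: "odd (f * s)"
    using index_2_consequences(1)[OF assms(1-4,6,8)] assms(9,12) by simp
  obtain j where "[p ^ j = 2] (mod n)"
    using index_2_consequences(2)[OF assms(1-4,6,8)] by (auto simp: n_def)
  \<comment> \<open>As \<open>n > 2\<close>, the actual remainder is \<open>2\<close>, so the locale
    parameter \<open>l\<close> becomes the quotient \<open>p ^ j div n\<close>.\<close>
  then have "p ^ j mod n = 2" using n2 by (simp add: cong_def)
  then have two: "CHAR('a) ^ j = 2 + n * (p ^ j div n)"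
    using mod_mult_div_eq[of "p ^ j" n] by (simp add: char)
  obtain \<psi> :: "'a \<Rightarrow> complex" where psi: "additive_character \<psi>" "\<And>x. \<psi> (x ^ CHAR('a)) = \<psi> x"
    using exists_frobenius_invariant_character[where ?'a = 'a, of "f * s"] card char by auto
  interpret two_frobenius \<psi> n j "p ^ j div n"
    using psi odd_card prim odd_n two
    by (auto simp: two_frobenius_def two_frobenius_axioms_def quadratic_gauss_sum_def
        quadratic_gauss_sum_axioms_def)
  have "[p ^ f = 1] (mod N)" using ord_divides[of p f N] assms(9) by simp
  then have "[CARD('a) = 1] (mod N)" using cong_pow[of "p ^ f" 1 N s] by (simp add: card power_mult)
  then have N_dvd: "N dvd CARD('a) - 1" by (rule cong_to_1_nat)
  have I_N: "I \<subseteq> {..<2 * n}" and I_mod: "(\<lambda>i. i mod n) ` I = {..<n}"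
    using assms(15,16) by (simp_all add: N n_def)
  \<comment> \<open>Surjectivity alone would allow both \<open>i\<close> and \<open>i + n\<close> in
    \<open>I\<close>; the hypothesis on \<open>card I\<close> makes \<open>I\<close> a transversal
    modulo \<open>n\<close>.\<close>
  have inj: "inj_on (\<lambda>i. i mod n) I"
    using assms(15-17) by (intro eq_card_imp_inj_on) (auto simp: n_def finite_subset)
  have mem: "\<gamma> ^ t \<in> D \<longleftrightarrow> t mod N \<in> I" for t
  proof -
    have "\<gamma> ^ t \<in> D \<longleftrightarrow> (\<exists>i\<in>I. t mod N = i mod N)"
      by (simp add: assms(18) power_mem_cyclotomic_class_iff[OF prim N_dvd] cong_def)
    also have "\<dots> \<longleftrightarrow> (\<exists>i\<in>I. t mod N = i)"
      using assms(15) by (intro bex_cong refl) (auto simp: subset_iff)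
    finally show ?thesis by simp
  qed
  have D0: "0 \<notin> D" using g0 by (auto simp: assms(18) cyclotomic_class_def)
  define S where "S = sign_of D"
  \<comment> \<open>Off \<open>0\<close>, where \<open>\<chi>\<close> is \<open>1\<close> or
    \<open>- 1\<close>, this product is also the quotient of \<open>S\<close> by
    \<open>\<chi>\<close>.\<close>
  define F where "F x = S x * \<chi> x" for x
  have S: "S x = F x * \<chi> x" for x
    using chi_mult_self[of x] by (cases "x = 0") (simp_all add: F_def S_def sign_of_def mult.assoc)
  have unimodular: "F x * cnj (F x) = 1" if "x \<noteq> 0" for x
    using that chi_mult_self[of x] by (auto simp: F_def S_def sign_of_def)
  \<comment> \<open>Multiplication by \<open>y ^ n\<close> with \<open>y = \<gamma> ^ i\<close> adds
    \<open>i * n\<close> to the exponent. For even \<open>i\<close> neither \<open>S\<close> nor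
    \<open>\<chi>\<close> changes; for odd \<open>i\<close> both change sign, \<open>S\<close> by
    \<open>transversal_shift\<close> and \<open>\<chi>\<close> because \<open>n\<close> is
    odd.\<close>
  have F_inv: "F (x * a) = F x" if aH: "a \<in> H" for x a
  proof (cases "x = 0")
    case False
    obtain t where t: "x = \<gamma> ^ t" using primitive_element_power_exists[OF prim False] .
    obtain y where y: "y \<noteq> 0" "a = y ^ n" using aH by (auto simp: H_def)
    obtain i where i: "y = \<gamma> ^ i" using primitive_element_power_exists[OF prim y(1)] .
    have xa: "x * a = \<gamma> ^ (t + i * n)" by (simp add: t y i power_add power_mult)
    have F_eq: "F (\<gamma> ^ k) = (if k mod N \<in> I then 1 else - 1) * (- 1) ^ k" for k
      using g0 by (simp add: F_def S_def sign_of_def mem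
          quadratic_character_power_primitive[OF prim odd_card])
    show ?thesis
    proof (cases "even i")
      case True
      then obtain l where "i = 2 * l" by blast
      then have "(t + i * n) mod N = t mod N" "even (i * n)" by (simp_all add: N mult.assoc mult.left_commute)
      then show ?thesis unfolding xa F_eq unfolding t F_eq by (simp add: power_add)
    next
      case False
      then obtain l where l: "i = 2 * l + 1" by (elim oddE)
      then have "t + i * n = t + n + N * l" by (simp add: N algebra_simps)
      then have "(t + i * n) mod N = (t + n) mod N" by (simp only: mod_mult_self2)
      then have "(t + i * n) mod N \<in> I \<longleftrightarrow> t mod N \<notin> I"
        using transversal_shift[OF I_N I_mod inj, of t] n2 by (simp add: N)
      moreover have "odd (i * n)" using False odd_n by simp
      ultimately show ?thesis unfolding xa F_eq unfolding t F_eq by (simp add: power_add)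
    qed
  qed (simp add: F_def)
  have sum_S: "(\<Sum>x\<in>UNIV. S x) = 0"
    by (rule autocorrelation(1)[OF F_inv unimodular S])
  have corr: "(\<Sum>x\<in>UNIV. S x * cnj (S (x - g))) = - 1" if "g \<noteq> 0" for g
    by (rule autocorrelation(2)[OF F_inv unimodular S that])
  have count: "4 * of_nat (difference_count D g) = of_nat CARD('a) - 3 - S g - S (- g)"
    if "g \<noteq> 0" for g
    using difference_count_eq_of_autocorrelation[OF D0 _ that] sum_S corr[OF that]
    by (simp add: S_def)
  have card_D: "2 * of_nat (card D) = (of_nat CARD('a) - 1 :: complex)"
    using card_eq_of_sum_sign[OF D0] sum_S by (simp add: S_def)
  \<comment> \<open>\<open>- 1\<close> lies in \<open>H\<close>, so \<open>F\<close> is even and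
    \<open>S\<close> has the parity of \<open>\<chi>\<close>.\<close>
  have S_uminus: "S (- x) = \<chi> (- 1) * S x" for x
    using F_inv[OF uminus_H[OF one_H], of x] chi_mult[of "- 1" x] S[of x] S[of "- x"] by simp
  have chi_m1: "\<chi> (- 1) = (- 1) ^ ((CARD('a) - 1) div 2)"
    by (rule quadratic_character_minus_one[OF prim odd_card])
  show ?thesis
  proof (intro conjI impI)
    assume p3: "[p = 3] (mod 4)"
    obtain k where "f * s = 2 * k + 1" using odd_fs by (elim oddE)
    then have "[CARD('a) = 3 ^ (2 * k + 1)] (mod 4)" using cong_pow[OF p3] by (simp only: card)
    also have "(3::nat) ^ (2 * k + 1) = 9 ^ k * 3" by (simp add: power_mult)
    also have "[9 ^ k * 3 = 1 ^ k * (3::nat)] (mod 4)"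
      by (intro cong_mult cong_pow cong_refl) (simp add: cong_def)
    finally have v4: "CARD('a) mod 4 = 3" by (simp add: cong_def)
    then have "\<chi> (- 1) = - 1" unfolding chi_m1 by (intro neg_one_odd_power) presburger
    \<comment> \<open>Oddness of \<open>S\<close> cancels the terms of \<open>count\<close> that
      depend on \<open>g\<close>, and it also yields the partition into \<open>D\<close>,
      \<open>- D\<close> and \<open>0\<close>.\<close>
    then have neg: "S (- x) = - S x" for x using S_uminus by simp
    have "of_nat (4 * difference_count D g + 3) = (of_nat CARD('a) :: complex)" if "g \<noteq> 0" for g
      using count[OF that] by (simp add: neg)
    then have dc: "4 * difference_count D g + 3 = CARD('a)" if "g \<noteq> 0" for g
      using that unfolding of_nat_eq_iff by blast
    have "difference_set CARD('a) (card D) ((CARD('a) - 3) div 4) D"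
      unfolding difference_set_def using dc by fastforce
    moreover have "x \<in> D \<or> - x \<in> D" if "x \<noteq> 0" for x
      using neg[of x] that by (auto simp: S_def sign_of_def split: if_splits)
    moreover have "- x \<notin> D" if "x \<in> D" for x
      using neg[of x] that D0 by (auto simp: S_def sign_of_def split: if_splits)
    moreover have "x \<in> uminus ` D \<longleftrightarrow> - x \<in> D" for x by (metis image_iff minus_minus)
    ultimately show "skew_hadamard_difference_set D"
      unfolding skew_hadamard_difference_set_def using D0 by auto
  next
    assume p1: "[p = 1] (mod 4)"
    have v4: "CARD('a) mod 4 = 1"
      using cong_pow[OF p1, of "f * s"] by (simp add: card cong_def)
    then have "\<chi> (- 1) = 1" unfolding chi_m1 by (intro neg_one_even_power) presburger
    \<comment> \<open>With \<open>S\<close> even, \<open>count\<close> becomes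
      \<open>CARD('a) - 3 - 2 * S g\<close>, which takes one value on \<open>D\<close> and another
      on the remaining nonzero elements.\<close>
    then have pos: "S (- x) = S x" for x using S_uminus by simp
    have in_D: "4 * difference_count D g + 5 = CARD('a)" if "g \<in> D" for g
    proof -
      have "g \<noteq> 0" using that D0 by auto
      then have "of_nat (4 * difference_count D g + 5) = (of_nat CARD('a) :: complex)"
        using count[of g] that by (simp add: pos) (simp add: S_def sign_of_def)
      then show ?thesis unfolding of_nat_eq_iff .
    qed
    have notin_D: "4 * difference_count D g + 1 = CARD('a)" if "g \<notin> D" "g \<noteq> 0" for g
    proof -
      have "of_nat (4 * difference_count D g + 1) = (of_nat CARD('a) :: complex)"
        using count[of g] that by (simp add: pos) (simp add: S_def sign_of_def)
      then show ?thesis unfolding of_nat_eq_iff .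
    qed
    have "of_nat (2 * card D + 1) = (of_nat CARD('a) :: complex)" using card_D by simp
    then have "2 * card D + 1 = CARD('a)" unfolding of_nat_eq_iff .
    then have "card D = (CARD('a) - 1) div 2" by simp
    moreover have "difference_count D g = (CARD('a) - 5) div 4" if "g \<in> D" for g
      using in_D[OF that] by simp
    moreover have "difference_count D g = (CARD('a) - 1) div 4" if "g \<notin> D" "g \<noteq> 0" for g
      using notin_D[OF that] by simp
    ultimately show "paley_type_pds D"
      unfolding paley_type_pds_def partial_difference_set_def Let_def using v4 D0 by auto
  qed
qed

end
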